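(* Let $G$ be a group acting on a tree $T$, with associated local action diagram $\Delta=(\Gamma,(X_a),(G(v)))$ and quotient map $\pi:T\to\Gamma=G\backslash T$. Then the invariant subtrees and fixed ends of the action naturally correspond to the strongly confluent partial orientations (scopos) of $\Delta$, with the empty scopo corresponding to $T$ itself. Explicitly: for each $z$ that is either a $G$-invariant subtree of $T$ or an end of $T$ fixed by $G$, $\pi(O_z)$ is a scopo of $\Delta$ with $\pi^{-1}(\pi(O_z))=O_z$; the map $z\mapsto\pi(O_z)$ is a bijection from the set of all $G$-invariant subtrees and $G$-fixed ends of $T$ to the set of all scopos of $\Delta$; and it sends $T$ to the empty scopo.
   Context: Graphs. A graph $\Gamma$ has a vertex set $V\Gamma$, an arc set $A\Gamma$, an origin map $o:A\Gamma\to V\Gamma$ and a reversal map $a\mapsto\overline a$ on $A\Gamma$ with $\overline{\overline a}=a$; $t(a):=o(\overline a)$. An arc with $o(a)=t(a)$ is a loop; for a loop both $\overline a=a$ and $\overline a\neq a$ are allowed. $o^{-1}(v)$ is the set of arcs with origin $v$. A tree is a nonempty connected graph without loops, multiple edges or cycles; subtrees are nonempty connected subgraphs. Ends of a tree are equivalence classes of rays (one-way infinite simple paths), two rays being equivalent if they share infinitely many vertices. $G\backslash T$ is the graph of $G$-orbits on vertices and arcs with induced origin and reversal maps. Associated local action diagram. $\Gamma=G\backslash T$ with quotient map $\pi$. For each $v\in V\Gamma$ choose $v^*\in\pi^{-1}(v)$; for $a\in o^{-1}(v)$ let $X_a=\{b\in o^{-1}(v^* ):\pi(b)=a\}$ and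 $X_v=o^{-1}(v^* )$; $G(v)$ is the closure in $\mathrm{Sym}(X_v)$ (topology of pointwise convergence) of the permutation group induced by $G_{v^*}$ on $X_v$. (It is unique up to isomorphism over $\Gamma$.) A strongly confluent partial orientation (scopo) of $\Delta=(\Gamma,(X_a),(G(v)))$ is a subset $O\subseteq A\Gamma$ such that: (i) if $a\in O$ then $\overline a\notin O$ and $|X_a|=1$; (ii) for all $v\in V\Gamma$, if $O$ contains an arc $a$ with $o(a)=v$, then $O$ contains all arcs other than $\overline a$ that terminate at $v$. For a subtree $T'$ of $T$, $O_{T'}$ is the set of arcs $a\in AT$ with $o(a)\notin VT'$ such that $a$ lies on the shortest directed path from $o(a)$ to $T'$. For an end $\xi$ of $T$, $O_\xi$ is the set of all arcs of $T$ directed towards $\xi$ (i.e. arcs $a$ such that some ray representing $\xi$ starts at $o(a)$ and has $a$ as its first arc). *)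

theory Defs
  imports "HOL-Algebra.Group_Action" "HOL-Analysis.Function_Topology"
begin

section \<open>Graphs\<close>

text \<open>Arcs are primitive and carry a reversal map; a loop may or may not equal its own reverse.\<close>

record ('v, 'a) graph =
  verts :: "'v set"
  arcs :: "'a set"
  origin :: "'a \<Rightarrow> 'v"
  reversal :: "'a \<Rightarrow> 'a"

definition is_graph :: "('v, 'a) graph \<Rightarrow> bool" where
  "is_graph \<Gamma> \<longleftrightarrow>
     origin \<Gamma> \<in> arcs \<Gamma> \<rightarrow> verts \<Gamma> \<and>
     reversal \<Gamma> \<in> arcs \<Gamma> \<rightarrow> arcs \<Gamma> \<and>
     (\<forall>a\<in>arcs \<Gamma>. reversal \<Gamma> (reversal \<Gamma> a) = a)"

definition terminus :: "('v, 'a) graph \<Rightarrow> 'a \<Rightarrow> 'v" where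
  "terminus \<Gamma> a = origin \<Gamma> (reversal \<Gamma> a)"

definition out_arcs :: "('v, 'a) graph \<Rightarrow> 'v \<Rightarrow> 'a set" where
  "out_arcs \<Gamma> v = {a \<in> arcs \<Gamma>. origin \<Gamma> a = v}"

fun walk :: "('v, 'a) graph \<Rightarrow> 'v \<Rightarrow> 'a list \<Rightarrow> 'v \<Rightarrow> bool" where
  "walk \<Gamma> u [] v \<longleftrightarrow> u \<in> verts \<Gamma> \<and> u = v"
| "walk \<Gamma> u (a # p) v \<longleftrightarrow> a \<in> out_arcs \<Gamma> u \<and> walk \<Gamma> (terminus \<Gamma> a) p v"

definition directed_path :: "('v, 'a) graph \<Rightarrow> 'v \<Rightarrow> 'a list \<Rightarrow> 'v \<Rightarrow> bool" where
  "directed_path \<Gamma> u p v \<longleftrightarrow> walk \<Gamma> u p v \<and> distinct (map (origin \<Gamma>) p @ [v])"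

definition graph_connected :: "('v, 'a) graph \<Rightarrow> bool" where
  "graph_connected \<Gamma> \<longleftrightarrow> (\<forall>u\<in>verts \<Gamma>. \<forall>v\<in>verts \<Gamma>. \<exists>p. directed_path \<Gamma> u p v)"

definition is_cycle :: "('v, 'a) graph \<Rightarrow> 'a list \<Rightarrow> bool" where
  "is_cycle \<Gamma> p \<longleftrightarrow>
     3 \<le> length p \<and> (\<exists>v. walk \<Gamma> v p v) \<and> distinct (map (origin \<Gamma>) p)"

text \<open>An edge is a pair \<open>{a, reversal \<Gamma> a}\<close>, so the third line below says that two arcs with the
  same endpoints belong to the same edge.\<close>

definition tree :: "('v, 'a) graph \<Rightarrow> bool" where
  "tree T \<longleftrightarrow> is_graph T \<and> verts T \<noteq> {} \<and> graph_connected T \<and>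
     (\<forall>a\<in>arcs T. origin T a \<noteq> terminus T a) \<and>
     (\<forall>a\<in>arcs T. \<forall>b\<in>arcs T. origin T a = origin T b \<and> terminus T a = terminus T b
        \<longrightarrow> b \<in> {a, reversal T a}) \<and>
     (\<nexists>p. is_cycle T p)"

text \<open>A subgraph keeps the whole (total) functions \<open>origin\<close> and \<open>reversal\<close> of the ambient graph, so
  that it is determined by its vertex and arc sets.\<close>

definition subgraph :: "('v, 'a) graph \<Rightarrow> ('v, 'a) graph \<Rightarrow> bool" where
  "subgraph S \<Gamma> \<longleftrightarrow> is_graph S \<and> verts S \<subseteq> verts \<Gamma> \<and> arcs S \<subseteq> arcs \<Gamma> \<and>
     origin S = origin \<Gamma> \<and> reversal S = reversal \<Gamma>"

definition subtree :: "('v, 'a) graph \<Rightarrow> ('v, 'a) graph \<Rightarrow> bool" where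
  "subtree S T \<longleftrightarrow> subgraph S T \<and> verts S \<noteq> {} \<and> graph_connected S"


section \<open>Rays and ends\<close>

text \<open>A ray is given by its sequence of arcs.\<close>

definition rays :: "('v, 'a) graph \<Rightarrow> (nat \<Rightarrow> 'a) set" where
  "rays T = {r. (\<forall>n. r n \<in> arcs T \<and> terminus T (r n) = origin T (r (Suc n))) \<and>
                inj (\<lambda>n. origin T (r n))}"

definition ray_equiv :: "('v, 'a) graph \<Rightarrow> ((nat \<Rightarrow> 'a) \<times> (nat \<Rightarrow> 'a)) set" where
  "ray_equiv T = {(r, s). r \<in> rays T \<and> s \<in> rays T \<and>
     infinite (range (\<lambda>n. origin T (r n)) \<inter> range (\<lambda>n. origin T (s n)))}"

definition ends :: "('v, 'a) graph \<Rightarrow> (nat \<Rightarrow> 'a) set set" where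
  "ends T = rays T // ray_equiv T"


section \<open>Arcs directed towards a subtree or an end\<close>

definition shortest_path_to :: "('v, 'a) graph \<Rightarrow> 'v \<Rightarrow> 'a list \<Rightarrow> 'v set \<Rightarrow> bool" where
  "shortest_path_to T u p W \<longleftrightarrow> (\<exists>w\<in>W. directed_path T u p w) \<and>
     (\<forall>q. \<forall>w\<in>W. directed_path T u q w \<longrightarrow> length p \<le> length q)"

definition towards_subtree :: "('v, 'a) graph \<Rightarrow> ('v, 'a) graph \<Rightarrow> 'a set" where
  "towards_subtree T S = {a \<in> arcs T. origin T a \<notin> verts S \<and>
     (\<exists>p. shortest_path_to T (origin T a) p (verts S) \<and> a \<in> set p)}"

definition towards_end :: "('v, 'a) graph \<Rightarrow> (nat \<Rightarrow> 'a) set \<Rightarrow> 'a set" where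
  "towards_end T \<xi> = {a \<in> arcs T. \<exists>r\<in>\<xi>. r 0 = a}"

definition towards :: "('v, 'a) graph \<Rightarrow> ('v, 'a) graph + (nat \<Rightarrow> 'a) set \<Rightarrow> 'a set" where
  "towards T z = (case z of Inl S \<Rightarrow> towards_subtree T S | Inr \<xi> \<Rightarrow> towards_end T \<xi>)"


section \<open>Group actions on graphs\<close>

text \<open>\<open>\<phi>\<close> is the action on vertices and \<open>\<psi>\<close> the action on arcs.\<close>

locale graph_action =
  fixes G :: "('g, 'm) monoid_scheme" and T :: "('v, 'a) graph"
    and \<phi> :: "'g \<Rightarrow> 'v \<Rightarrow> 'v" and \<psi> :: "'g \<Rightarrow> 'a \<Rightarrow> 'a"
  assumes verts_action: "group_action G (verts T) \<phi>"
    and arcs_action: "group_action G (arcs T) \<psi>"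
    and origin_equivariant:
      "\<lbrakk>g \<in> carrier G; a \<in> arcs T\<rbrakk> \<Longrightarrow> origin T (\<psi> g a) = \<phi> g (origin T a)"
    and reversal_equivariant:
      "\<lbrakk>g \<in> carrier G; a \<in> arcs T\<rbrakk> \<Longrightarrow> reversal T (\<psi> g a) = \<psi> g (reversal T a)"

definition invariant_subtrees ::
  "('g, 'm) monoid_scheme \<Rightarrow> ('v, 'a) graph \<Rightarrow> ('g \<Rightarrow> 'v \<Rightarrow> 'v) \<Rightarrow> ('g \<Rightarrow> 'a \<Rightarrow> 'a)
     \<Rightarrow> ('v, 'a) graph set" where
  "invariant_subtrees G T \<phi> \<psi> = {S. subtree S T \<and>
     (\<forall>g\<in>carrier G. \<phi> g ` verts S = verts S \<and> \<psi> g ` arcs S = arcs S)}"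

definition fixed_ends ::
  "('g, 'm) monoid_scheme \<Rightarrow> ('v, 'a) graph \<Rightarrow> ('g \<Rightarrow> 'a \<Rightarrow> 'a) \<Rightarrow> (nat \<Rightarrow> 'a) set set" where
  "fixed_ends G T \<psi> = {\<xi> \<in> ends T. \<forall>g\<in>carrier G. (\<lambda>r. \<psi> g \<circ> r) ` \<xi> = \<xi>}"

text \<open>Vertices and arcs of the quotient are orbits, so the quotient map is \<open>orbit G \<phi>\<close> on vertices
  and \<open>orbit G \<psi>\<close> on arcs. By equivariance the image of the orbit of \<open>a\<close> under \<open>origin T\<close> is the
  orbit of \<open>origin T a\<close>, and likewise for the reversal.\<close>

definition quotient_graph ::
  "('g, 'm) monoid_scheme \<Rightarrow> ('v, 'a) graph \<Rightarrow> ('g \<Rightarrow> 'v \<Rightarrow> 'v) \<Rightarrow> ('g \<Rightarrow> 'a \<Rightarrow> 'a)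
     \<Rightarrow> ('v set, 'a set) graph" where
  "quotient_graph G T \<phi> \<psi> =
     \<lparr>verts = orbits G (verts T) \<phi>, arcs = orbits G (arcs T) \<psi>,
      origin = (\<lambda>A. origin T ` A), reversal = (\<lambda>A. reversal T ` A)\<rparr>"


section \<open>Local action diagrams\<close>

record ('v, 'a, 'x) local_action_diagram =
  base :: "('v, 'a) graph"
  colours :: "'a \<Rightarrow> 'x set"
  local_group :: "'v \<Rightarrow> ('x \<Rightarrow> 'x) set"

definition sym_topology :: "'x set \<Rightarrow> ('x \<Rightarrow> 'x) topology" where
  "sym_topology X =
     subtopology (product_topology (\<lambda>_. discrete_topology X) X) (carrier (BijGroup X))"

definition associated_diagram ::
  "('g, 'm) monoid_scheme \<Rightarrow> ('v, 'a) graph \<Rightarrow> ('g \<Rightarrow> 'v \<Rightarrow> 'v) \<Rightarrow> ('g \<Rightarrow> 'a \<Rightarrow> 'a)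
     \<Rightarrow> ('v set \<Rightarrow> 'v) \<Rightarrow> ('v set, 'a set, 'a) local_action_diagram" where
  "associated_diagram G T \<phi> \<psi> star =
     (let \<Gamma> = quotient_graph G T \<phi> \<psi> in
      \<lparr>base = \<Gamma>,
       colours = (\<lambda>a. {b \<in> out_arcs T (star (origin \<Gamma> a)). orbit G \<psi> b = a}),
       local_group = (\<lambda>v. let X = out_arcs T (star v) in
          sym_topology X closure_of
            {restrict (\<psi> g) X |g. g \<in> stabilizer G \<phi> (star v)})\<rparr>)"

definition scopo :: "('v, 'a, 'x) local_action_diagram \<Rightarrow> 'a set \<Rightarrow> bool" where
  "scopo \<Delta> O' \<longleftrightarrow> O' \<subseteq> arcs (base \<Delta>) \<and>
     (\<forall>a\<in>O'. reversal (base \<Delta>) a \<notin> O' \<and> card (colours \<Delta> a) = 1) \<and>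
     (\<forall>v\<in>verts (base \<Delta>). \<forall>a\<in>O'. origin (base \<Delta>) a = v \<longrightarrow>
        (\<forall>b\<in>arcs (base \<Delta>). terminus (base \<Delta>) b = v \<and> b \<noteq> reversal (base \<Delta>) a \<longrightarrow> b \<in> O'))"

end

theory Submission
  imports Defs
begin

text \<open>
  Pulled back to \<open>T\<close>, a scopo becomes a \<open>G\<close>-invariant set \<open>O\<close> of arcs that contains no arc together
  with its reverse and such that, whenever \<open>a \<in> O\<close>, every arc ending at the origin of \<open>a\<close>, other than
  the reverse of \<open>a\<close>, is in \<open>O\<close>. These two conditions alone force at most one arc of \<open>O\<close> to leave
  each vertex. If some vertex has no outgoing arc in \<open>O\<close>, then such vertices span a subtree and
  \<open>O\<close> points towards it. Otherwise every vertex starts a unique ray with all arcs in \<open>O\<close>; these rays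
  form one end, and \<open>O\<close> points towards it. Since the subtree or end is thus determined by \<open>O\<close> and
  conversely, one is \<open>G\<close>-invariant if and only if the other is.
\<close>

section \<open>Reduced walks in a tree\<close>

text \<open>The delicate point of pulling back is the excepted arc. In the quotient, condition (ii)
  excepts the whole orbit of \<open>reversal T a\<close>; in \<open>T\<close> it must except a
  single arc. An arc \<open>b\<close> of that orbit ending at the origin of \<open>a\<close> has its
  reverse in the orbit of \<open>a\<close> and leaving the same vertex, and \<open>|X_a| = 1\<close>
  forces this reverse to be \<open>a\<close>. Conversely, arcs of one orbit are all in the pulled
  back set or all outside it, so the bound of one outgoing arc gives back \<open>|X_a| = 1\<close>.
  The geometry runs on walks without backtracking. This is a local condition, so a concatenation
  only has to be checked at the junction, whereas distinctness of vertices is global. It also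
  matches confluence, whose excepted arc is precisely a backtrack: membership in \<open>O\<close>
  spreads backwards along such walks, and both reconstructions rest on this.\<close>

definition reduced :: "('v, 'a) graph \<Rightarrow> 'a list \<Rightarrow> bool" where
  "reduced T p \<longleftrightarrow> successively (\<lambda>a b. b \<noteq> reversal T a) p"

locale tree_graph =
  fixes T :: "('v, 'a) graph"
  assumes tree: "tree T"
begin

lemma graph: "is_graph T"
  using tree by (simp add: tree_def)

lemma origin_in_verts [simp]: "a \<in> arcs T \<Longrightarrow> origin T a \<in> verts T"
  using graph by (auto simp: is_graph_def)

lemma reversal_in_arcs [simp]: "a \<in> arcs T \<Longrightarrow> reversal T a \<in> arcs T"
  using graph by (auto simp: is_graph_def)

lemma reversal_reversal [simp]: "a \<in> arcs T \<Longrightarrow> reversal T (reversal T a) = a"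
  using graph by (auto simp: is_graph_def)

lemma terminus_in_verts [simp]: "a \<in> arcs T \<Longrightarrow> terminus T a \<in> verts T"
  by (simp add: terminus_def)

lemma origin_reversal [simp]: "origin T (reversal T a) = terminus T a"
  by (simp add: terminus_def)

lemma terminus_reversal [simp]: "a \<in> arcs T \<Longrightarrow> terminus T (reversal T a) = origin T a"
  by (simp add: terminus_def)

lemma no_loop: "a \<in> arcs T \<Longrightarrow> origin T a \<noteq> terminus T a"
  using tree by (auto simp: tree_def)

lemma reversal_neq [simp]: "a \<in> arcs T \<Longrightarrow> reversal T a \<noteq> a"
  by (metis no_loop origin_reversal)

text \<open>The tree axiom leaves the option \<open>b = reversal T a\<close>, but reversal swaps the
  endpoints, so \<open>a\<close> would be a loop.\<close>

lemma no_multiple_edges: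
  assumes "a \<in> arcs T" "b \<in> arcs T" "origin T a = origin T b" "terminus T a = terminus T b"
  shows "a = b"
proof -
  have "b \<in> {a, reversal T a}"
    using tree assms unfolding tree_def by blast
  then show ?thesis
    using assms no_loop by fastforce
qed

lemma walk_arcs: "walk T u p v \<Longrightarrow> set p \<subseteq> arcs T"
  by (induction p arbitrary: u) (auto simp: out_arcs_def)

lemma walk_start: "walk T u p v \<Longrightarrow> u \<in> verts T"
  by (cases p) (auto simp: out_arcs_def)

lemma walk_append: "walk T u (p @ q) v \<longleftrightarrow> (\<exists>w. walk T u p w \<and> walk T w q v)"
  by (induction p arbitrary: u) (auto intro: walk_start)

lemma walk_snoc: "walk T u (p @ [a]) v \<longleftrightarrow>
    walk T u p (origin T a) \<and> a \<in> arcs T \<and> terminus T a = v"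
  by (auto simp: walk_append out_arcs_def)

lemma walk_reverse: "walk T u p v \<Longrightarrow> walk T v (rev (map (reversal T) p)) u"
proof (induction p arbitrary: u)
  case (Cons a p)
  then show ?case
    by (auto simp: walk_snoc out_arcs_def)
qed auto

lemma reduced_Nil [simp]: "reduced T []"
  by (simp add: reduced_def)

lemma reduced_Cons: "reduced T (a # p) \<longleftrightarrow> p = [] \<or> hd p \<noteq> reversal T a \<and> reduced T p"
  by (simp add: reduced_def successively_Cons)

lemma reduced_append: "reduced T (p @ q) \<longleftrightarrow> reduced T p \<and> reduced T q \<and>
    (p = [] \<or> q = [] \<or> hd q \<noteq> reversal T (last p))"
  by (simp add: reduced_def successively_append_iff)

lemma reduced_reverse:
  assumes "set p \<subseteq> arcs T" "reduced T p"
  shows "reduced T (rev (map (reversal T) p))"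
  using assms
proof (induction p)
  case (Cons a p)
  have "reversal T a \<noteq> reversal T (reversal T (hd p))" if "p \<noteq> []"
  proof -
    have "hd p \<in> arcs T" using Cons.prems that by auto
    then show ?thesis using Cons.prems that by (auto simp: reduced_Cons)
  qed
  then show ?case
    using Cons by (auto simp: reduced_Cons reduced_append last_rev hd_map)
qed auto

text \<open>The arcs up to the first return to a vertex would form a cycle.\<close>

lemma reduced_walk_distinct:
  assumes "walk T u p v" "reduced T p"
  shows "distinct (map (origin T) p @ [v])"
  using assms
proof (induction p arbitrary: u)
  case (Cons a p)
  let ?t = "terminus T a"
  have a: "a \<in> arcs T" "origin T a = u" and p: "walk T ?t p v"
    using Cons.prems by (auto simp: out_arcs_def)
  have dist: "distinct (map (origin T) p @ [v])"
    using Cons by (auto simp: reduced_Cons out_arcs_def)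
  have "u \<notin> set (map (origin T) p @ [v])"
  proof
    assume u: "u \<in> set (map (origin T) p @ [v])"
    have "\<exists>p1 p2. p = p1 @ p2 \<and> walk T ?t p1 u \<and> u \<notin> origin T ` set p1"
    proof (cases "u = v")
      case True
      then show ?thesis using dist p by force
    next
      case False
      then obtain b where "b \<in> set p" "origin T b = u" using u by auto
      then obtain p1 p2 where "p = p1 @ b # p2" by (meson split_list)
      then show ?thesis
        using p dist \<open>origin T b = u\<close>
        by (intro exI[of _ p1] exI[of _ "b # p2"]) (auto simp: walk_append out_arcs_def)
    qed
    then obtain p1 p2 where split: "p = p1 @ p2" "walk T ?t p1 u" "u \<notin> origin T ` set p1"
      by blast
    \<comment> \<open>\<open>is_cycle\<close> asks for length at least three. Length one for
      \<open>a # p1\<close> would make \<open>a\<close> a loop; length two would make its second arc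
      the reverse of \<open>a\<close>, as there are no multiple edges.\<close>
    have "p1 \<noteq> []"
      using split(2) a no_loop[OF a(1)] by (metis walk.simps(1))
    moreover have "p1 \<noteq> [b]" for b
    proof
      assume "p1 = [b]"
      then have b: "b \<in> arcs T" "origin T b = ?t" "terminus T b = u"
        using split by (auto simp: out_arcs_def)
      then have "b = reversal T a"
        using a by (intro no_multiple_edges) auto
      then show False
        using Cons.prems split \<open>p1 = [b]\<close> by (simp add: reduced_Cons)
    qed
    ultimately have "3 \<le> length (a # p1)"
      by (cases p1; cases "tl p1") auto
    moreover have "walk T u (a # p1) u"
      using a split by (simp add: out_arcs_def)
    ultimately have "is_cycle T (a # p1)"
      using dist split a by (auto simp: is_cycle_def)
    then show False
      using tree by (auto simp: tree_def)
  qed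
  then show ?case using dist a by simp
qed auto

section \<open>Uniqueness of reduced walks\<close>

lemma reduced_closed_walk:
  assumes "walk T u p u" "reduced T p"
  shows "p = []"
proof (cases p)
  case (Cons a q)
  then show ?thesis
    using reduced_walk_distinct[OF assms] assms(1) by (simp add: out_arcs_def)
qed

text \<open>Common first arcs are stripped. Once the first arcs differ, one walk reversed and
  followed by the other is reduced and closed, hence empty.\<close>

lemma reduced_walk_unique:
  assumes "walk T u p v" "reduced T p" "walk T u q v" "reduced T q"
  shows "p = q"
  using assms
proof (induction p arbitrary: u q)
  case Nil
  then show ?case using reduced_closed_walk by auto
next
  case (Cons a p)
  show ?case
  proof (cases q)
    case Nil
    then show ?thesis using Cons.prems reduced_closed_walk[of u "a # p"] by simp
  next
    case q: (Cons b q')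
    show ?thesis
    proof (cases "a = b")
      case True
      then show ?thesis
        using Cons.IH[of "terminus T a" q'] Cons.prems q by (auto simp: reduced_Cons)
    next
      case False
      \<comment> \<open>At its junction \<open>reversal T a\<close> is followed by \<open>b\<close>,
        which is a backtrack only if \<open>a = b\<close>.\<close>
      let ?c = "rev (map (reversal T) (a # p)) @ q"
      have "set (a # p) \<subseteq> arcs T" using Cons.prems(1) by (rule walk_arcs)
      then have "reduced T ?c"
        using Cons.prems reduced_reverse[of "a # p"] False q
        by (subst reduced_append) auto
      moreover have "walk T v ?c v"
        using Cons.prems walk_reverse walk_append by blast
      ultimately show ?thesis
        using reduced_closed_walk by blast
    qed
  qed
qed

text \<open>Trades the global condition on vertices for the local one on consecutive arcs: a
  backtrack over \<open>a\<close> revisits the origin of \<open>a\<close> at once, and the converse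
  is \<open>reduced_walk_distinct\<close>.\<close>

lemma directed_path_iff: "directed_path T u p v \<longleftrightarrow> walk T u p v \<and> reduced T p"
proof
  assume "directed_path T u p v"
  then have "walk T u p v" "distinct (map (origin T) p @ [v])"
    by (auto simp: directed_path_def)
  then have "reduced T p"
  proof (induction p arbitrary: u)
    case (Cons a p)
    have "hd p \<noteq> reversal T a" if ne: "p \<noteq> []"
    proof
      assume "hd p = reversal T a"
      then obtain q where "p = reversal T a # q"
        using ne by (cases p) auto
      then have "walk T (origin T a) q v"
        using Cons.prems(1) by (auto simp: out_arcs_def)
      then have "origin T a \<in> set (map (origin T) q @ [v])"
        by (cases q) (auto simp: out_arcs_def)
      then show False
        using Cons.prems(2) \<open>p = reversal T a # q\<close> by auto
    qed
    then show ?case using Cons by (auto simp: reduced_Cons)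
  qed auto
  then show "walk T u p v \<and> reduced T p" using \<open>walk T u p v\<close> by blast
next
  assume "walk T u p v \<and> reduced T p"
  then show "directed_path T u p v"
    using reduced_walk_distinct[of u p v] unfolding directed_path_def by blast
qed

lemma reduced_walk_exists:
  assumes "u \<in> verts T" "v \<in> verts T"
  obtains p where "walk T u p v" "reduced T p"
  using tree assms unfolding tree_def graph_connected_def directed_path_iff by blast


section \<open>Strongly confluent orientations of a tree\<close>

text \<open>The conditions of a scopo with all \<open>|X\<^sub>a| = 1\<close>, that is, for
  the trivial group acting on \<open>T\<close>.\<close>

definition confluent :: "'a set \<Rightarrow> bool" where
  "confluent O' \<longleftrightarrow> O' \<subseteq> arcs T \<and>
     (\<forall>a\<in>O'. reversal T a \<notin> O' \<and>
        (\<forall>b\<in>arcs T. terminus T b = origin T a \<and> b \<noteq> reversal T a \<longrightarrow> b \<in> O'))"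

text \<open>These will be the vertices of the subtree to be recovered; their absence signals an
  end.\<close>

definition sinks :: "'a set \<Rightarrow> 'v set" where
  "sinks O' = {v \<in> verts T. \<forall>a\<in>O'. origin T a \<noteq> v}"

lemma confluent_arcs: "confluent O' \<Longrightarrow> a \<in> O' \<Longrightarrow> a \<in> arcs T"
  by (auto simp: confluent_def)

lemma confluent_reversal: "confluent O' \<Longrightarrow> a \<in> O' \<Longrightarrow> reversal T a \<notin> O'"
  by (auto simp: confluent_def)

lemma confluent_incoming:
  "\<lbrakk>confluent O'; a \<in> O'; b \<in> arcs T; terminus T b = origin T a; b \<noteq> reversal T a\<rbrakk> \<Longrightarrow> b \<in> O'"
  by (auto simp: confluent_def)

text \<open>If \<open>a\<close> and \<open>b\<close> differ, the reverse of \<open>b\<close> ends at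
  the origin of \<open>a\<close> and is not the excepted arc, so confluence puts it into
  \<open>O'\<close> together with \<open>b\<close>.\<close>

lemma confluent_unique:
  assumes "confluent O'" "a \<in> O'" "b \<in> O'" "origin T a = origin T b"
  shows "a = b"
proof (rule ccontr)
  assume "a \<noteq> b"
  have arcs: "a \<in> arcs T" "b \<in> arcs T" using assms confluent_arcs by auto
  then have "reversal T b \<noteq> reversal T a" using \<open>a \<noteq> b\<close> by (metis reversal_reversal)
  then have "reversal T b \<in> O'"
    using assms arcs by (intro confluent_incoming[OF assms(1,2)]) auto
  then show False using assms confluent_reversal by blast
qed

text \<open>In a reduced walk no arc is the reverse of its successor, so the exception in confluence
  never applies and membership passes from each arc to the one before.\<close>

lemma confluent_path_backwards:
  assumes "confluent O'" "walk T u (p @ [a]) v" "reduced T (p @ [a])" "a \<in> O'"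
  shows "set (p @ [a]) \<subseteq> O'"
  using assms(2,3)
proof (induction p arbitrary: u)
  case (Cons b p)
  let ?q = "p @ [a]"
  have b: "b \<in> arcs T" and q: "walk T (terminus T b) ?q v" "reduced T ?q"
    using Cons.prems by (auto simp: reduced_Cons out_arcs_def)
  then have sub: "set ?q \<subseteq> O'" using Cons.IH by blast
  then have "hd ?q \<in> O'" by (meson hd_in_set snoc_eq_iff_butlast subsetD)
  moreover have "origin T (hd ?q) = terminus T b"
    using q(1) by (cases ?q) (auto simp: out_arcs_def)
  moreover have "hd ?q \<noteq> reversal T b"
    using Cons.prems(2) by (simp add: reduced_Cons)
  ultimately have "b \<in> O'"
    using b by (intro confluent_incoming[OF assms(1), of "hd ?q" b]) (auto simp: confluent_arcs[OF assms(1)])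
  then show ?case using sub by simp
qed (use assms(4) in auto)

text \<open>Some \<open>c\<close> in \<open>O'\<close> leaves the origin of \<open>a\<close>. Were
  it not \<open>a\<close>, confluence at \<open>c\<close> would put \<open>reversal T a\<close> into
  \<open>O'\<close>, and this arc leaves a sink.\<close>

lemma confluent_into_sink:
  assumes "confluent O'" "a \<in> arcs T" "origin T a \<notin> sinks O'" "terminus T a \<in> sinks O'"
  shows "a \<in> O'"
proof -
  obtain c where c: "c \<in> O'" "origin T c = origin T a"
    using assms by (auto simp: sinks_def)
  have "c = a"
  proof (rule ccontr)
    assume "c \<noteq> a"
    then have "reversal T a \<noteq> reversal T c"
      using assms c confluent_arcs by (metis reversal_reversal)
    then have "reversal T a \<in> O'"
      using assms c by (intro confluent_incoming[OF assms(1) c(1)]) auto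
    then show False using assms(4) by (auto simp: sinks_def)
  qed
  then show ?thesis using c by simp
qed

text \<open>If the walk left the sinks, its last arc starting outside them would enter a sink and so
  lie in \<open>O'\<close>. Going backwards, the first arc of the walk would lie in
  \<open>O'\<close> too, yet it starts at the sink \<open>u\<close>.\<close>

lemma sinks_convex:
  assumes "confluent O'" "u \<in> sinks O'" "v \<in> sinks O'" "walk T u p v" "reduced T p"
  shows "origin T ` set p \<subseteq> sinks O'"
proof (rule ccontr)
  assume "\<not> ?thesis"
  then have "\<exists>a\<in>set p. origin T a \<notin> sinks O'" by auto
  then obtain p1 a p2 where split: "p = p1 @ a # p2" "origin T a \<notin> sinks O'"
    "\<forall>b\<in>set p2. origin T b \<in> sinks O'"
    using split_list_last_prop[of p "\<lambda>a. origin T a \<notin> sinks O'"] by auto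
  have "walk T u (p1 @ [a]) (terminus T a)" "walk T (terminus T a) p2 v" "a \<in> arcs T"
    using assms(4) split(1) by (auto simp: walk_append out_arcs_def)
  moreover have "terminus T a \<in> sinks O'"
    using \<open>walk T (terminus T a) p2 v\<close> split(3) assms(3)
    by (cases p2) (auto simp: out_arcs_def)
  ultimately have "a \<in> O'" using confluent_into_sink assms(1) split(2) by blast
  moreover have "reduced T (p1 @ [a])"
    using assms(5) split(1) by (auto simp: reduced_append reduced_Cons)
  ultimately have "set (p1 @ [a]) \<subseteq> O'"
    using confluent_path_backwards assms(1) \<open>walk T u (p1 @ [a]) (terminus T a)\<close> by blast
  then have "hd (p1 @ [a]) \<in> O'" by (meson hd_in_set snoc_eq_iff_butlast subsetD)
  moreover have "origin T (hd (p1 @ [a])) = u"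
    using \<open>walk T u (p1 @ [a]) (terminus T a)\<close> by (cases p1) (auto simp: out_arcs_def)
  ultimately show False using assms(2) by (auto simp: sinks_def)
qed


section \<open>Subtrees\<close>

text \<open>A shortest path to \<open>W\<close> is characterised by meeting \<open>W\<close> only at its last vertex.\<close>

definition entry_path :: "'v set \<Rightarrow> 'v \<Rightarrow> 'a list \<Rightarrow> 'v \<Rightarrow> bool" where
  "entry_path W u p w \<longleftrightarrow>
     walk T u p w \<and> reduced T p \<and> w \<in> W \<and> (\<forall>a\<in>set p. origin T a \<notin> W)"

lemma entry_path_prefix:
  assumes "walk T u q v" "reduced T q" "v \<in> W"
  obtains p w r where "q = p @ r" "entry_path W u p w"
proof (cases "\<exists>b\<in>set q. origin T b \<in> W")
  case False
  then show ?thesis using assms that[of q "[]" v] by (auto simp: entry_path_def)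
next
  case True
  then obtain p b r where split: "q = p @ b # r" "origin T b \<in> W" "\<forall>a\<in>set p. origin T a \<notin> W"
    using split_list_first_prop[of q "\<lambda>b. origin T b \<in> W"] by auto
  then have "entry_path W u p (origin T b)"
    using assms by (auto simp: entry_path_def walk_append reduced_append out_arcs_def)
  then show ?thesis using that split(1) by blast
qed

lemma entry_path_exists:
  assumes "u \<in> verts T" "W \<subseteq> verts T" "W \<noteq> {}"
  obtains p w where "entry_path W u p w"
proof -
  obtain v where "v \<in> W" "v \<in> verts T" using assms by auto
  then show ?thesis
    using that assms(1) by (metis entry_path_prefix reduced_walk_exists)
qed

section \<open>Convexity of subtrees\<close>

lemma subgraph_terminus: "subgraph S T \<Longrightarrow> terminus S a = terminus T a"
  by (simp add: terminus_def subgraph_def del: origin_reversal)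

lemma subgraph_walk:
  assumes "subgraph S T" "walk S u p v"
  shows "walk T u p v"
  using assms(2)
proof (induction p arbitrary: u)
  case Nil
  then show ?case using assms(1) by (auto simp: subgraph_def)
next
  case (Cons a p)
  then show ?case using assms(1) subgraph_terminus[OF assms(1), of a]
    by (auto simp: subgraph_def out_arcs_def)
qed

lemma subgraph_directed_path:
  "subgraph S T \<Longrightarrow> directed_path S u p v \<longleftrightarrow> walk S u p v \<and> reduced T p"
  using directed_path_iff[of u p v] subgraph_walk[of S u p v]
  by (auto simp: directed_path_def subgraph_def)

text \<open>Connectedness supplies a reduced walk inside \<open>S\<close>, and uniqueness in
  \<open>T\<close> identifies it with \<open>p\<close>.\<close>

lemma subtree_convex:
  assumes "subtree S T" "u \<in> verts S" "v \<in> verts S" "walk T u p v" "reduced T p"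
  shows "walk S u p v"
proof -
  have sub: "subgraph S T" using assms(1) by (simp add: subtree_def)
  obtain q where "directed_path S u q v"
    using assms by (auto simp: subtree_def graph_connected_def)
  then have "walk S u q v" "reduced T q"
    using subgraph_directed_path[OF sub] by auto
  moreover have "q = p"
    using calculation assms subgraph_walk[OF sub] reduced_walk_unique by blast
  ultimately show ?thesis by simp
qed

text \<open>An arc between two vertices of \<open>S\<close> is a reduced walk of length one, so
  convexity applies. Hence a subtree is determined by its vertex set, and knowing the sinks suffices
  to recover it.\<close>

lemma subtree_arcs:
  assumes "subtree S T"
  shows "arcs S = {a \<in> arcs T. origin T a \<in> verts S \<and> terminus T a \<in> verts S}"
proof (rule Set.set_eqI, rule iffI)
  fix a assume "a \<in> arcs S"
  then show "a \<in> {a \<in> arcs T. origin T a \<in> verts S \<and> terminus T a \<in> verts S}"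
    using assms unfolding subtree_def subgraph_def is_graph_def
    by (auto simp: Pi_iff simp flip: origin_reversal)
next
  fix a assume a: "a \<in> {a \<in> arcs T. origin T a \<in> verts S \<and> terminus T a \<in> verts S}"
  then have "walk T (origin T a) [a] (terminus T a)" "reduced T [a]"
    by (auto simp: out_arcs_def reduced_def)
  then have "walk S (origin T a) [a] (terminus T a)"
    using subtree_convex[OF assms] a by blast
  then show "a \<in> arcs S" by (simp add: out_arcs_def)
qed

lemma subtree_verts: "subtree S T \<Longrightarrow> verts S \<subseteq> verts T"
  by (auto simp: subtree_def subgraph_def)

lemma subtree_walk_origins:
  assumes "subtree S T" "walk S u p v"
  shows "origin T ` set p \<subseteq> verts S"
proof -
  have "set p \<subseteq> arcs S"
    using assms(2) by (induction p arbitrary: u) (auto simp: out_arcs_def)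
  then show ?thesis using subtree_arcs[OF assms(1)] by auto
qed

section \<open>Entry paths and the arcs directed towards a subtree\<close>

lemma entry_path_extend:
  assumes "subtree S T" "entry_path (verts S) u p w" "w' \<in> verts S" "walk T u q w'" "reduced T q"
  obtains s where "q = p @ s" "origin T ` set s \<subseteq> verts S"
proof -
  have p: "walk T u p w" "reduced T p" "w \<in> verts S" "\<forall>a\<in>set p. origin T a \<notin> verts S"
    using assms(2) by (auto simp: entry_path_def)
  then obtain s where s: "walk T w s w'" "reduced T s"
    using reduced_walk_exists subtree_verts[OF assms(1)] assms(3) by blast
  have os: "origin T ` set s \<subseteq> verts S"
    using subtree_walk_origins[OF assms(1)] subtree_convex[OF assms(1) p(3) assms(3) s] by blast
  have arcs_s: "set s \<subseteq> arcs S"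
  proof -
    have "walk S w s w'" using subtree_convex[OF assms(1) p(3) assms(3) s] .
    then show ?thesis by (induction s arbitrary: w) (auto simp: out_arcs_def)
  qed
  \<comment> \<open>The last arc of \<open>p\<close> starts outside \<open>S\<close>, while the
    first arc of \<open>s\<close> stays in \<open>S\<close>; hence \<open>p @ s\<close> does not
    backtrack and must be \<open>q\<close>.\<close>
  have "hd s \<noteq> reversal T (last p)" if "p \<noteq> []" "s \<noteq> []"
  proof
    assume eq: "hd s = reversal T (last p)"
    have "last p \<in> arcs T" using walk_arcs[OF p(1)] that by auto
    then have "terminus T (hd s) = origin T (last p)" using eq by simp
    moreover have "terminus T (hd s) \<in> verts S"
    proof -
      have "hd s \<in> arcs S" using arcs_s that by auto
      then show ?thesis using subtree_arcs[OF assms(1)] by blast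
    qed
    ultimately show False using p(4) that by auto
  qed
  then have "reduced T (p @ s)" using p s by (auto simp: reduced_append)
  moreover have "walk T u (p @ s) w'" using p s walk_append by blast
  ultimately have "q = p @ s" using reduced_walk_unique assms by blast
  then show ?thesis using that os by blast
qed

lemma entry_path_unique:
  assumes "subtree S T" "entry_path (verts S) u p w" "entry_path (verts S) u q w'"
  shows "p = q"
proof -
  obtain s where "q = p @ s" "origin T ` set s \<subseteq> verts S"
    using entry_path_extend[OF assms(1,2)] assms(3) unfolding entry_path_def by metis
  moreover have "\<forall>a\<in>set q. origin T a \<notin> verts S" using assms(3) by (simp add: entry_path_def)
  ultimately show ?thesis by (cases s) auto
qed

text \<open>A shortest path cannot be cut earlier, so it is an entry path; conversely every path to
  \<open>S\<close> extends the entry path from its start, which is therefore shortest.\<close>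

lemma towards_subtree_iff:
  assumes "subtree S T"
  shows "a \<in> towards_subtree T S \<longleftrightarrow> (\<exists>p w. entry_path (verts S) (origin T a) (a # p) w)"
proof
  assume "a \<in> towards_subtree T S"
  then obtain p w where p: "a \<in> set p" "w \<in> verts S" "directed_path T (origin T a) p w"
    and short: "\<And>q w. \<lbrakk>w \<in> verts S; directed_path T (origin T a) q w\<rbrakk> \<Longrightarrow> length p \<le> length q"
    unfolding towards_subtree_def shortest_path_to_def by blast
  then obtain p' w' r where entry: "p = p' @ r" "entry_path (verts S) (origin T a) p' w'"
    using entry_path_prefix directed_path_iff by metis
  then have "length p \<le> length p'"
    by (intro short[of w']) (auto simp: entry_path_def directed_path_iff)
  then have ep: "entry_path (verts S) (origin T a) p w'" using entry by simp
  \<comment> \<open>\<open>a\<close> is only known to lie somewhere on \<open>p\<close>; the part of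
    \<open>p\<close> from \<open>a\<close> onwards is again an entry path.\<close>
  obtain p1 p2 where "p = p1 @ a # p2" using p(1) by (meson split_list)
  then have "entry_path (verts S) (origin T a) (a # p2) w'"
    using ep by (auto simp: entry_path_def walk_append reduced_append out_arcs_def)
  then show "\<exists>p w. entry_path (verts S) (origin T a) (a # p) w" by blast
next
  assume "\<exists>p w. entry_path (verts S) (origin T a) (a # p) w"
  then obtain p w where ep: "entry_path (verts S) (origin T a) (a # p) w" by blast
  then have "length (a # p) \<le> length q"
    if "w' \<in> verts S" "directed_path T (origin T a) q w'" for q w'
    using entry_path_extend[OF assms ep that(1)] that(2)
    by (metis directed_path_iff le_add1 length_append)
  then have "shortest_path_to T (origin T a) (a # p) (verts S)"
    using ep unfolding shortest_path_to_def entry_path_def directed_path_iff by blast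
  moreover have "a \<in> arcs T" "origin T a \<notin> verts S"
    using ep by (auto simp: entry_path_def out_arcs_def)
  ultimately show "a \<in> towards_subtree T S"
    unfolding towards_subtree_def by (auto intro!: exI[of _ "a # p"])
qed

text \<open>Entry paths stay entry paths when the first arc is dropped or an arc is prefixed without
  backtracking. In the second case a new origin in \<open>S\<close> would, by convexity, drag the
  origin of \<open>a\<close> into \<open>S\<close>.\<close>

lemma confluent_towards_subtree:
  assumes "subtree S T"
  shows "confluent (towards_subtree T S)"
  unfolding confluent_def
proof (intro conjI ballI impI)
  show "towards_subtree T S \<subseteq> arcs T" by (auto simp: towards_subtree_def)
next
  fix a assume "a \<in> towards_subtree T S"
  then obtain p w where p: "entry_path (verts S) (origin T a) (a # p) w"
    using towards_subtree_iff[OF assms] by blast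
  then have a: "a \<in> arcs T" "walk T (terminus T a) p w"
    by (auto simp: entry_path_def out_arcs_def)
  then have p': "entry_path (verts S) (terminus T a) p w"
    using p by (auto simp: entry_path_def reduced_Cons)
  show "reversal T a \<notin> towards_subtree T S"
  proof
    assume "reversal T a \<in> towards_subtree T S"
    then obtain q w' where "entry_path (verts S) (terminus T a) (reversal T a # q) w'"
      using towards_subtree_iff[OF assms] by auto
    then have "p = reversal T a # q" using entry_path_unique[OF assms p'] by blast
    then show False using p by (simp add: entry_path_def reduced_Cons)
  qed
  fix b assume b: "b \<in> arcs T" "terminus T b = origin T a \<and> b \<noteq> reversal T a"
  have "a \<noteq> reversal T b"
    using b by auto
  then have red: "reduced T (b # a # p)"
    using p by (simp add: entry_path_def reduced_Cons[of b])
  have walk: "walk T (origin T b) (b # a # p) w"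
    using a b by (simp add: out_arcs_def)
  have "origin T b \<notin> verts S"
  proof
    assume "origin T b \<in> verts S"
    moreover have "w \<in> verts S" using p by (simp add: entry_path_def)
    ultimately have "origin T ` set (b # a # p) \<subseteq> verts S"
      using subtree_walk_origins[OF assms] subtree_convex[OF assms _ _ walk red] by blast
    then show False using p by (auto simp: entry_path_def)
  qed
  then have "entry_path (verts S) (origin T b) (b # a # p) w"
    using p red walk by (auto simp: entry_path_def)
  then show "b \<in> towards_subtree T S" using towards_subtree_iff[OF assms] by blast
qed

lemma sinks_towards_subtree:
  assumes "subtree S T"
  shows "sinks (towards_subtree T S) = verts S"
proof (rule Set.set_eqI, rule iffI)
  fix v assume v: "v \<in> sinks (towards_subtree T S)"
  then have "v \<in> verts T" by (simp add: sinks_def)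
  then obtain p w where p: "entry_path (verts S) v p w"
    using entry_path_exists[of v "verts S"] subtree_verts[OF assms] assms
    by (auto simp: subtree_def)
  show "v \<in> verts S"
  proof (cases p)
    case Nil
    then show ?thesis using p by (simp add: entry_path_def)
  next
    case (Cons a q)
    then have "origin T a = v" using p by (simp add: entry_path_def out_arcs_def)
    then have "a \<in> towards_subtree T S" using towards_subtree_iff[OF assms] p Cons by blast
    then show ?thesis using v \<open>origin T a = v\<close> by (auto simp: sinks_def)
  qed
next
  fix v assume "v \<in> verts S"
  then show "v \<in> sinks (towards_subtree T S)"
    using subtree_verts[OF assms] by (auto simp: sinks_def towards_subtree_def)
qed

section \<open>The subtree spanned by the sinks\<close>

definition sink_subgraph :: "'a set \<Rightarrow> ('v, 'a) graph" where
  "sink_subgraph O' = \<lparr>verts = sinks O',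
     arcs = {a \<in> arcs T. origin T a \<in> sinks O' \<and> terminus T a \<in> sinks O'},
     origin = origin T, reversal = reversal T\<rparr>"

lemma sink_subgraph_simps [simp]:
  "verts (sink_subgraph O') = sinks O'"
  "arcs (sink_subgraph O') = {a \<in> arcs T. origin T a \<in> sinks O' \<and> terminus T a \<in> sinks O'}"
  "origin (sink_subgraph O') = origin T"
  "reversal (sink_subgraph O') = reversal T"
  "terminus (sink_subgraph O') = terminus T"
  by (auto simp: sink_subgraph_def terminus_def simp del: origin_reversal)

lemma subtree_sink_subgraph:
  assumes "confluent O'" "sinks O' \<noteq> {}"
  shows "subtree (sink_subgraph O') T"
proof -
  let ?S = "sink_subgraph O'"
  have sub: "subgraph ?S T"
    by (auto simp: subgraph_def is_graph_def sinks_def)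
  have "\<exists>p. directed_path ?S u p v" if uv: "u \<in> sinks O'" "v \<in> sinks O'" for u v
  proof -
    obtain p where p: "walk T u p v" "reduced T p"
      using reduced_walk_exists uv by (auto simp: sinks_def)
    have "walk ?S u p v" using p(1) sinks_convex[OF assms(1) uv p]
    proof (induction p arbitrary: u)
      case (Cons a p)
      then have "terminus T a \<in> sinks O'"
        using uv(2) by (cases p) (auto simp: out_arcs_def)
      then show ?case using Cons by (auto simp: out_arcs_def)
    qed (use uv in auto)
    then show ?thesis using p subgraph_directed_path[OF sub] by blast
  qed
  then show ?thesis using sub assms(2) by (auto simp: subtree_def graph_connected_def)
qed

text \<open>The last arc of an entry path enters a sink, so it lies in \<open>O'\<close>, and so do
  all arcs before it. Conversely, the entry path from the origin of an arc of \<open>O'\<close>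
  begins with an arc of \<open>O'\<close>, which must be that same arc.\<close>

lemma towards_sink_subgraph:
  assumes "confluent O'" "sinks O' \<noteq> {}"
  shows "towards_subtree T (sink_subgraph O') = O'"
proof -
  let ?W = "sinks O'"
  note iff = towards_subtree_iff[OF subtree_sink_subgraph[OF assms], simplified]
  have entry: "set p \<subseteq> O'" if "entry_path ?W u p w" for u p w
  proof (cases p rule: rev_cases)
    case (snoc q a)
    then have "walk T u (q @ [a]) w" "reduced T (q @ [a])" "w \<in> ?W" "origin T a \<notin> ?W"
      using that by (auto simp: entry_path_def)
    then have "a \<in> O'"
      using confluent_into_sink[OF assms(1)] by (auto simp: walk_snoc)
    then show ?thesis
      using confluent_path_backwards[OF assms(1)] \<open>walk T u (q @ [a]) w\<close>
        \<open>reduced T (q @ [a])\<close> snoc by blast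
  qed auto
  show ?thesis
  proof (rule Set.set_eqI, rule iffI)
    fix a assume "a \<in> towards_subtree T (sink_subgraph O')"
    then show "a \<in> O'" using iff entry by (metis list.set_intros(1) subsetD)
  next
    fix a assume a: "a \<in> O'"
    then have "origin T a \<in> verts T" using confluent_arcs[OF assms(1)] by auto
    then obtain p w where p: "entry_path ?W (origin T a) p w"
      using entry_path_exists[of "origin T a" ?W] assms(2) by (auto simp: sinks_def)
    have "origin T a \<notin> ?W" using a by (auto simp: sinks_def)
    then obtain b q where q: "p = b # q"
      using p by (cases p) (auto simp: entry_path_def)
    have "b \<in> O'" using entry[OF p] q by simp
    moreover have "origin T b = origin T a" using p q by (simp add: entry_path_def out_arcs_def)
    ultimately have "b = a" using confluent_unique[OF assms(1)] a by blast
    then show "a \<in> towards_subtree T (sink_subgraph O')" using iff p q by blast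
  qed
qed

lemma sink_subgraph_towards:
  assumes "subtree S T"
  shows "sink_subgraph (towards_subtree T S) = S"
proof -
  have "origin S = origin T" "reversal S = reversal T"
    using assms by (auto simp: subtree_def subgraph_def)
  then show ?thesis
    unfolding sink_subgraph_def sinks_towards_subtree[OF assms] subtree_arcs[OF assms, symmetric]
    by simp
qed


section \<open>Rays and ends of a tree\<close>

lemma ray_arcs: "r \<in> rays T \<Longrightarrow> r n \<in> arcs T"
  by (simp add: rays_def)

lemma ray_origin_Suc: "r \<in> rays T \<Longrightarrow> origin T (r (Suc n)) = terminus T (r n)"
  by (simp add: rays_def)

lemma ray_origin_inj: "r \<in> rays T \<Longrightarrow> origin T (r m) = origin T (r n) \<longleftrightarrow> m = n"
  by (auto simp: rays_def inj_def)

lemma ray_reduced: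
  assumes "r \<in> rays T"
  shows "r (Suc n) \<noteq> reversal T (r n)"
proof
  assume "r (Suc n) = reversal T (r n)"
  then have "origin T (r (Suc (Suc n))) = origin T (r n)"
    using ray_origin_Suc[OF assms, of "Suc n"] ray_arcs[OF assms, of n] by simp
  then show False using ray_origin_inj[OF assms] by simp
qed

text \<open>The hypotheses are local instead of \<open>r \<in> rays T\<close>, because the lemma
  also serves to prove that a sequence is a ray.\<close>

lemma reduced_walk_upt:
  assumes "\<And>n. r n \<in> arcs T" "\<And>n. origin T (r (Suc n)) = terminus T (r n)"
    and "\<And>n. r (Suc n) \<noteq> reversal T (r n)" and "m \<le> n"
  shows "walk T (origin T (r m)) (map r [m..<n]) (origin T (r n)) \<and> reduced T (map r [m..<n])"
  using assms(4)
proof (induction n rule: dec_induct)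
  case base
  then show ?case using assms(1) by simp
next
  case (step n)
  have "last (map r [m..<n]) = r (n - 1)" "n - 1 < n" if "m < n"
    using that by (auto simp: last_map)
  then have "reduced T (map r [m..<n] @ [r n])"
    using step assms(3)[of "n - 1"] by (auto simp: reduced_append reduced_Cons)
  moreover have "walk T (origin T (r m)) (map r [m..<n] @ [r n]) (origin T (r (Suc n)))"
    using step assms by (simp add: walk_snoc)
  ultimately show ?case using step(1) by simp
qed

text \<open>Injectivity comes for free: a repeated origin would close up a nonempty reduced
  walk.\<close>

lemma raysI:
  assumes "\<And>n. r n \<in> arcs T" "\<And>n. origin T (r (Suc n)) = terminus T (r n)"
    and "\<And>n. r (Suc n) \<noteq> reversal T (r n)"
  shows "r \<in> rays T"
proof -
  have "origin T (r m) \<noteq> origin T (r n)" if "m < n" for m n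
  proof
    assume "origin T (r m) = origin T (r n)"
    then have "map r [m..<n] = []"
      using reduced_walk_upt[of r, OF assms less_imp_le[OF that]] reduced_closed_walk by metis
    then show False using that by simp
  qed
  then have "inj (\<lambda>n. origin T (r n))"
    by (intro linorder_injI) auto
  then show ?thesis using assms by (simp add: rays_def)
qed

lemma ray_walk:
  assumes "r \<in> rays T" "m \<le> n"
  shows "walk T (origin T (r m)) (map r [m..<n]) (origin T (r n))" "reduced T (map r [m..<n])"
  using reduced_walk_upt[of r m n] ray_arcs[OF assms(1)] ray_origin_Suc[OF assms(1)]
    ray_reduced[OF assms(1)] assms(2) by auto

lemma ray_tail:
  assumes "r \<in> rays T"
  shows "(\<lambda>i. r (n + i)) \<in> rays T"
  using ray_arcs[OF assms] ray_origin_Suc[OF assms] ray_reduced[OF assms]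
  by (intro raysI) auto

lemma ray_cons:
  assumes "r \<in> rays T" "b \<in> arcs T" "terminus T b = origin T (r 0)" "r 0 \<noteq> reversal T b"
  shows "case_nat b r \<in> rays T"
proof (rule raysI)
  fix n
  show "case_nat b r n \<in> arcs T"
    using assms ray_arcs by (cases n) auto
  show "origin T (case_nat b r (Suc n)) = terminus T (case_nat b r n)"
    using assms ray_origin_Suc by (cases n) auto
  show "case_nat b r (Suc n) \<noteq> reversal T (case_nat b r n)"
    using assms ray_reduced by (cases n) auto
qed

text \<open>Between two common vertices both rays follow the same reduced walk. With common vertices
  arbitrarily far out, they agree from their first chosen meeting point on, up to a shift of
  indices.\<close>

lemma ray_equiv_iff:
  "(r, s) \<in> ray_equiv T \<longleftrightarrow>
     r \<in> rays T \<and> s \<in> rays T \<and> (\<exists>m n. \<forall>i. r (m + i) = s (n + i))"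
proof (intro iffI conjI; (elim conjE exE)?)
  assume rs: "(r, s) \<in> ray_equiv T"
  then show r: "r \<in> rays T" and s: "s \<in> rays T" by (auto simp: ray_equiv_def)
  let ?I = "range (\<lambda>n. origin T (r n)) \<inter> range (\<lambda>n. origin T (s n))"
  have inf: "infinite ?I" using rs by (simp add: ray_equiv_def)
  then have "?I \<noteq> {}" by (metis finite.emptyI)
  then obtain x where "x \<in> ?I" by blast
  then obtain m n where mn: "origin T (r m) = origin T (s n)" by auto
  have "r (m + i) = s (n + i)" for i
  proof -
    \<comment> \<open>A common vertex outside this finite set comes after index \<open>m + i\<close>
      on \<open>r\<close> and after \<open>n\<close> on \<open>s\<close>, so the segments to be
      compared are long enough to contain position \<open>i\<close>.\<close>
    let ?F = "(\<lambda>k. origin T (r k)) ` {..m + i} \<union> (\<lambda>k. origin T (s k)) ` {..n}"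
    have "\<not> ?I \<subseteq> ?F" using inf finite_subset by blast
    then obtain m' n' where eq: "origin T (r m') = origin T (s n')"
      and "origin T (r m') \<notin> ?F" by blast
    then have gt: "m + i < m'" "n < n'"
      by (force simp: not_le[symmetric])+
    have "map r [m..<m'] = map s [n..<n']"
      using ray_walk[OF r, of m m'] ray_walk[OF s, of n n'] gt mn eq
      by (intro reduced_walk_unique[of "origin T (r m)" _ "origin T (r m')"]) auto
    moreover from this have "m' - m = n' - n" by (metis length_map length_upt)
    ultimately have "map r [m..<m'] ! i = map s [n..<n'] ! i" "i < m' - m" "i < n' - n"
      using gt by auto
    then show ?thesis by simp
  qed
  then show "\<exists>m n. \<forall>i. r (m + i) = s (n + i)" by blast
next
  fix m n assume r: "r \<in> rays T" and s: "s \<in> rays T" and eq: "\<forall>i. r (m + i) = s (n + i)"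
  have "infinite (range (\<lambda>i. origin T (r (m + i))))"
    using ray_origin_inj[OF r] by (intro range_inj_infinite) (auto simp: inj_def)
  moreover have "range (\<lambda>i. origin T (r (m + i)))
      \<subseteq> range (\<lambda>n. origin T (r n)) \<inter> range (\<lambda>n. origin T (s n))"
    using eq by (intro Int_greatest image_subsetI) (blast, metis rangeI)
  ultimately show "(r, s) \<in> ray_equiv T"
    using r s infinite_super unfolding ray_equiv_def by blast
qed

lemma equiv_ray_equiv: "equiv (rays T) (ray_equiv T)"
proof (rule equivI)
  show "ray_equiv T \<subseteq> rays T \<times> rays T" by (auto simp: ray_equiv_def)
  show "refl_on (rays T) (ray_equiv T)" by (auto simp: refl_on_def ray_equiv_iff)
  show "sym (ray_equiv T)" by (rule symI) (metis ray_equiv_iff)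
  show "trans (ray_equiv T)"
  proof (rule transI)
    fix r s t assume rs: "(r, s) \<in> ray_equiv T" and st: "(s, t) \<in> ray_equiv T"
    then obtain m n n' k where "\<forall>i. r (m + i) = s (n + i)" "\<forall>i. s (n' + i) = t (k + i)"
      by (auto simp: ray_equiv_iff)
    \<comment> \<open>Both sides equal \<open>s (n + n' + i)\<close>.\<close>
    then have "r (m + n' + i) = t (k + n + i)" for i
      by (metis add.assoc add.left_commute)
    then show "(r, t) \<in> ray_equiv T" using rs st by (auto simp: ray_equiv_iff)
  qed
qed

lemma ray_equiv_tail: "r \<in> rays T \<Longrightarrow> (r, \<lambda>i. r (n + i)) \<in> ray_equiv T"
  unfolding ray_equiv_iff using ray_tail by (intro conjI exI[of _ n] exI[of _ 0]) auto

text \<open>The initial segments up to a meeting point are reduced walks with equal endpoints, so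
  they coincide and the index shift is zero.\<close>

lemma ray_equiv_same_origin:
  assumes "(r, s) \<in> ray_equiv T" "origin T (r 0) = origin T (s 0)"
  shows "r = s"
proof -
  have r: "r \<in> rays T" and s: "s \<in> rays T" using assms(1) by (auto simp: ray_equiv_iff)
  obtain m n where mn: "\<forall>i. r (m + i) = s (n + i)" using assms(1) by (auto simp: ray_equiv_iff)
  then have "r m = s n" by (metis add_0_right)
  then have maps: "map r [0..<m] = map s [0..<n]"
    using ray_walk[OF r, of 0 m] ray_walk[OF s, of 0 n] assms(2)
    by (intro reduced_walk_unique[of "origin T (r 0)" _ "origin T (r m)"]) auto
  then have "m = n" by (metis length_map length_upt diff_zero)
  have "r i = s i" for i
  proof (cases "i < m")
    case True
    then show ?thesis using maps \<open>m = n\<close> by auto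
  next
    case False
    then show ?thesis using mn \<open>m = n\<close> by (metis le_add_diff_inverse not_le)
  qed
  then show ?thesis by auto
qed

section \<open>Ends and the arcs directed towards them\<close>

lemma end_rays: "\<xi> \<in> ends T \<Longrightarrow> r \<in> \<xi> \<Longrightarrow> r \<in> rays T"
  unfolding ends_def using in_quotient_imp_subset[OF equiv_ray_equiv] by blast

lemma end_equiv: "\<xi> \<in> ends T \<Longrightarrow> r \<in> \<xi> \<Longrightarrow> s \<in> \<xi> \<Longrightarrow> (r, s) \<in> ray_equiv T"
  unfolding ends_def using in_quotient_imp_in_rel[OF equiv_ray_equiv] by blast

lemma end_closed: "\<xi> \<in> ends T \<Longrightarrow> r \<in> \<xi> \<Longrightarrow> (r, s) \<in> ray_equiv T \<Longrightarrow> s \<in> \<xi>"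
  unfolding ends_def using in_quotient_imp_closed[OF equiv_ray_equiv] by blast

lemma end_nonempty: "\<xi> \<in> ends T \<Longrightarrow> \<xi> \<noteq> {}"
  unfolding ends_def using in_quotient_imp_non_empty[OF equiv_ray_equiv] by blast

lemma end_tail: "\<xi> \<in> ends T \<Longrightarrow> r \<in> \<xi> \<Longrightarrow> (\<lambda>i. r (n + i)) \<in> \<xi>"
  using end_closed end_rays ray_equiv_tail by blast

lemma end_cons:
  assumes "\<xi> \<in> ends T" "r \<in> \<xi>" "b \<in> arcs T" "terminus T b = origin T (r 0)" "r 0 \<noteq> reversal T b"
  shows "case_nat b r \<in> \<xi>"
proof -
  have "r \<in> rays T" "case_nat b r \<in> rays T"
    using assms end_rays ray_cons by auto
  then have "(r, case_nat b r) \<in> ray_equiv T"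
    unfolding ray_equiv_iff by (intro conjI exI[of _ 0] exI[of _ 1]) auto
  then show ?thesis using end_closed assms by blast
qed

lemma end_same_origin:
  "\<lbrakk>\<xi> \<in> ends T; r \<in> \<xi>; s \<in> \<xi>; origin T (r 0) = origin T (s 0)\<rbrakk> \<Longrightarrow> r = s"
  using end_equiv ray_equiv_same_origin by blast

lemma end_arc: "\<xi> \<in> ends T \<Longrightarrow> r \<in> \<xi> \<Longrightarrow> r n \<in> towards_end T \<xi>"
  using end_tail[of \<xi> r n] end_rays[of \<xi> r] ray_arcs[of r n]
  by (auto simp: towards_end_def intro!: bexI[of _ "\<lambda>i. r (n + i)"])

text \<open>An end is closed under tails and under prolongation without backtracking. If
  \<open>a\<close> and its reverse both pointed to \<xi>, a ray starting with the reverse would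
  equal the tail of \<open>r\<close> after \<open>a\<close>, and \<open>r\<close> would
  backtrack.\<close>

lemma confluent_towards_end:
  assumes \<xi>: "\<xi> \<in> ends T"
  shows "confluent (towards_end T \<xi>)"
  unfolding confluent_def
proof (intro conjI ballI impI)
  show "towards_end T \<xi> \<subseteq> arcs T" by (auto simp: towards_end_def)
next
  fix a assume "a \<in> towards_end T \<xi>"
  then obtain r where r: "r \<in> \<xi>" "r 0 = a" "a \<in> arcs T" by (auto simp: towards_end_def)
  then have ray: "r \<in> rays T" using end_rays \<xi> by blast
  show "reversal T a \<notin> towards_end T \<xi>"
  proof
    assume "reversal T a \<in> towards_end T \<xi>"
    then obtain s where s: "s \<in> \<xi>" "s 0 = reversal T a" by (auto simp: towards_end_def)
    have "(\<lambda>i. r (1 + i)) = s"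
      using end_same_origin[OF \<xi> end_tail[OF \<xi> r(1)] s(1), of 1] ray_origin_Suc[OF ray, of 0] r s
      by simp
    then have "r (Suc 0) = s 0" by auto
    then show False using s r ray_reduced[OF ray, of 0] by auto
  qed
  fix b assume b: "b \<in> arcs T" "terminus T b = origin T a \<and> b \<noteq> reversal T a"
  then have "a \<noteq> reversal T b" by auto
  then have "case_nat b r \<in> \<xi>" using end_cons[OF \<xi> r(1) b(1)] b r by simp
  then show "b \<in> towards_end T \<xi>"
    using b by (auto simp: towards_end_def intro!: bexI[of _ "case_nat b r"])
qed

text \<open>Moving the start back along one arc of a walk either prolongs the ray by that arc or, if
  this would backtrack, drops the first arc of the ray.\<close>

lemma end_ray_from:
  assumes \<xi>: "\<xi> \<in> ends T" and "u \<in> verts T"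
  obtains r where "r \<in> \<xi>" "origin T (r 0) = u"
proof -
  obtain s where s: "s \<in> \<xi>" using end_nonempty[OF \<xi>] by auto
  then have "origin T (s 0) \<in> verts T" using end_rays[OF \<xi>] ray_arcs by auto
  then obtain p where "walk T u p (origin T (s 0))"
    using reduced_walk_exists assms(2) by blast
  then have "\<exists>r\<in>\<xi>. origin T (r 0) = u"
  proof (induction p arbitrary: u)
    case Nil
    then show ?case using s by auto
  next
    case (Cons a p)
    then have a: "a \<in> arcs T" "origin T a = u" by (auto simp: out_arcs_def)
    obtain r where r: "r \<in> \<xi>" "origin T (r 0) = terminus T a" using Cons by auto
    show ?case
    proof (cases "r 0 = reversal T a")
      case True
      then have "origin T (r (1 + 0)) = u"
        using ray_origin_Suc[OF end_rays[OF \<xi> r(1)], of 0] a by simp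
      then show ?thesis using end_tail[OF \<xi> r(1), of 1] by (intro bexI)
    next
      case False
      then have "case_nat a r \<in> \<xi>" using end_cons[OF \<xi> r(1) a(1)] r by simp
      then show ?thesis using a by (intro bexI[of _ "case_nat a r"]) auto
    qed
  qed
  then show ?thesis using that by blast
qed

lemma sinks_towards_end:
  assumes "\<xi> \<in> ends T"
  shows "sinks (towards_end T \<xi>) = {}"
proof -
  have "\<exists>a\<in>towards_end T \<xi>. origin T a = v" if "v \<in> verts T" for v
    using end_ray_from[OF assms that] end_arc[OF assms] by metis
  then show ?thesis by (auto simp: sinks_def)
qed

section \<open>The end formed by the rays inside a confluent set\<close>

definition rays_in :: "'a set \<Rightarrow> (nat \<Rightarrow> 'a) set" where
  "rays_in O' = {r \<in> rays T. range r \<subseteq> O'}"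

lemma rays_in_arc: "r \<in> rays_in O' \<Longrightarrow> r n \<in> O'"
  by (auto simp: rays_in_def)

lemma rays_in_tail: "r \<in> rays_in O' \<Longrightarrow> (\<lambda>i. r (n + i)) \<in> rays_in O'"
  using ray_tail by (auto simp: rays_in_def)

text \<open>At each vertex \<open>O'\<close> offers at most one way to continue.\<close>

lemma rays_in_same_origin:
  assumes "confluent O'" "r \<in> rays_in O'" "s \<in> rays_in O'" "origin T (r 0) = origin T (s 0)"
  shows "r = s"
proof
  fix n
  have rays: "r \<in> rays T" "s \<in> rays T" using assms by (auto simp: rays_in_def)
  have "origin T (r n) = origin T (s n)"
  proof (induction n)
    case (Suc n)
    then have "r n = s n"
      using confluent_unique[OF assms(1)] rays_in_arc assms(2,3) by blast
    then show ?case using ray_origin_Suc rays by simp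
  qed (use assms in simp)
  then show "r n = s n"
    using confluent_unique[OF assms(1)] rays_in_arc assms(2,3) by blast
qed

lemma rays_in_towards_end:
  assumes \<xi>: "\<xi> \<in> ends T"
  shows "rays_in (towards_end T \<xi>) = \<xi>"
proof
  show sub: "\<xi> \<subseteq> rays_in (towards_end T \<xi>)"
    using end_arc[OF \<xi>] end_rays[OF \<xi>] by (auto simp: rays_in_def)
  show "rays_in (towards_end T \<xi>) \<subseteq> \<xi>"
  proof
    fix r assume r: "r \<in> rays_in (towards_end T \<xi>)"
    then obtain s where s: "s \<in> \<xi>" "s 0 = r 0"
      using rays_in_arc[OF r, of 0] by (auto simp: towards_end_def)
    then have "r = s"
      using rays_in_same_origin[OF confluent_towards_end[OF \<xi>] r] sub by auto
    then show "r \<in> \<xi>" using s by simp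
  qed
qed

lemma rays_in_from_arc:
  assumes "confluent O'" "sinks O' = {}" "a \<in> O'"
  obtains r where "r \<in> rays_in O'" "r 0 = a"
proof -
  have "\<exists>c\<in>O'. origin T c = terminus T b" if "b \<in> O'" for b
  proof -
    have "terminus T b \<in> verts T" using confluent_arcs[OF assms(1) that] by simp
    then show ?thesis using assms(2) by (auto simp: sinks_def)
  qed
  then obtain f where f: "\<And>b. b \<in> O' \<Longrightarrow> f b \<in> O' \<and> origin T (f b) = terminus T b"
    by metis
  define r where "r n = (f ^^ n) a" for n
  have rO: "r n \<in> O'" for n
    by (induction n) (use f assms(3) in \<open>auto simp: r_def\<close>)
  have "r \<in> rays T"
  proof (rule raysI)
    fix n
    show "r n \<in> arcs T" using rO confluent_arcs[OF assms(1)] by blast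
    show "origin T (r (Suc n)) = terminus T (r n)" using f[OF rO[of n]] by (simp add: r_def)
    \<comment> \<open>Successors are chosen inside \<open>O'\<close>, which never contains an arc
      with its reverse.\<close>
    show "r (Suc n) \<noteq> reversal T (r n)" using rO confluent_reversal[OF assms(1)] by metis
  qed
  then show ?thesis using that[of r] rO by (auto simp: rays_in_def r_def)
qed

lemma rays_in_from_vertex:
  assumes "confluent O'" "sinks O' = {}" "u \<in> verts T"
  obtains r where "r \<in> rays_in O'" "origin T (r 0) = u"
proof -
  obtain a where "a \<in> O'" "origin T a = u" using assms(2,3) by (auto simp: sinks_def)
  then show ?thesis using that rays_in_from_arc[OF assms(1,2)] by metis
qed

text \<open>Induction along a walk between the origins. For one arc \<open>a\<close> leading from
  the origin of \<open>r\<close> to that of \<open>t\<close>, one ray is the other without its first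
  arc: either \<open>a\<close> reverses the first arc of \<open>t\<close>, or confluence puts
  \<open>a\<close> into \<open>O'\<close> and \<open>r\<close> begins with \<open>a\<close>.\<close>

lemma rays_in_equiv:
  assumes O': "confluent O'" "sinks O' = {}" and "r \<in> rays_in O'" and s: "s \<in> rays_in O'"
  shows "(r, s) \<in> ray_equiv T"
proof -
  have rays: "t \<in> rays T" if "t \<in> rays_in O'" for t using that by (simp add: rays_in_def)
  have refl: "(t, t) \<in> ray_equiv T" if "t \<in> rays_in O'" for t
    using equiv_ray_equiv rays[OF that] by (meson equivE refl_onD)
  have trans: "(x, y) \<in> ray_equiv T \<Longrightarrow> (y, z) \<in> ray_equiv T \<Longrightarrow> (x, z) \<in> ray_equiv T" for x y z
    using equiv_ray_equiv by (meson equivE transD)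
  have sym: "(x, y) \<in> ray_equiv T \<Longrightarrow> (y, x) \<in> ray_equiv T" for x y
    using equiv_ray_equiv by (meson equivE symD)
  obtain p where "walk T (origin T (r 0)) p (origin T (s 0))"
    using reduced_walk_exists[OF origin_in_verts origin_in_verts]
      ray_arcs[OF rays[OF assms(3)], of 0] ray_arcs[OF rays[OF s], of 0] by blast
  then show ?thesis using assms(3)
  proof (induction p arbitrary: r)
    case Nil
    then have "r = s" using rays_in_same_origin[OF O'(1) _ s] by simp
    then show ?case using refl s by simp
  next
    case (Cons a p)
    then have a: "a \<in> arcs T" "origin T a = origin T (r 0)"
      and p: "walk T (terminus T a) p (origin T (s 0))" by (auto simp: out_arcs_def)
    obtain t where t: "t \<in> rays_in O'" "origin T (t 0) = terminus T a"
      using rays_in_from_vertex[OF O', of "terminus T a"] a by auto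
    then have ts: "(t, s) \<in> ray_equiv T" using Cons.IH[of t] p by simp
    show ?case
    proof (cases "a = reversal T (t 0)")
      case True
      then have "origin T (t (1 + 0)) = origin T (r 0)"
        using ray_origin_Suc[OF rays[OF t(1)], of 0] a by simp
      then have "(\<lambda>i. t (1 + i)) = r"
        using rays_in_same_origin[OF O'(1) rays_in_tail[OF t(1)] Cons.prems(2)] by blast
      then have "(t, r) \<in> ray_equiv T" using ray_equiv_tail[OF rays[OF t(1)], of 1] by simp
      then show ?thesis using ts sym trans by blast
    next
      case False
      then have "a \<in> O'"
        using confluent_incoming[OF O'(1) rays_in_arc[OF t(1), of 0] a(1)] t by simp
      then have "r 0 = a"
        using confluent_unique[OF O'(1)] rays_in_arc[OF Cons.prems(2)] a by metis
      then have "origin T (r (1 + 0)) = origin T (t 0)"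
        using ray_origin_Suc[OF rays[OF Cons.prems(2)], of 0] t by simp
      then have "(\<lambda>i. r (1 + i)) = t"
        using rays_in_same_origin[OF O'(1) rays_in_tail[OF Cons.prems(2)] t(1)] by blast
      then have "(r, t) \<in> ray_equiv T" using ray_equiv_tail[OF rays[OF Cons.prems(2)], of 1] by simp
      then show ?thesis using ts trans by blast
    qed
  qed
qed

text \<open>Being a full equivalence class needs that a ray which is eventually in \<open>O'\<close>
  lies in \<open>O'\<close> from the start; this is backward propagation.\<close>

lemma rays_in_end:
  assumes O': "confluent O'" "sinks O' = {}"
  shows "rays_in O' \<in> ends T"
proof -
  obtain u where "u \<in> verts T" using tree by (auto simp: tree_def)
  then obtain s where s: "s \<in> rays_in O'" using rays_in_from_vertex[OF O'] by blast
  have "rays_in O' = ray_equiv T `` {s}"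
  proof
    show "rays_in O' \<subseteq> ray_equiv T `` {s}" using rays_in_equiv[OF O' s] by blast
    show "ray_equiv T `` {s} \<subseteq> rays_in O'"
    proof
      fix r assume "r \<in> ray_equiv T `` {s}"
      then obtain m n where r: "r \<in> rays T" and mn: "\<forall>i. s (m + i) = r (n + i)"
        by (auto simp: ray_equiv_iff)
      have "r i \<in> O'" for i
      proof -
        have "r (n + i) \<in> O'" using mn rays_in_arc[OF s] by metis
        \<comment> \<open>The arc \<open>r i\<close> is the last one listed if \<open>n = 0\<close>
          and one of the earlier ones otherwise.\<close>
        then have "set (map r [0..<n + i] @ [r (n + i)]) \<subseteq> O'"
          using ray_walk[OF r, of 0 "Suc (n + i)"]
          by (intro confluent_path_backwards[OF O'(1)]) auto
        then show ?thesis by (cases "n = 0") auto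
      qed
      then show "r \<in> rays_in O'" using r by (auto simp: rays_in_def)
    qed
  qed
  then show ?thesis using s by (auto simp: ends_def rays_in_def intro: quotientI)
qed

lemma towards_rays_in:
  assumes O': "confluent O'" "sinks O' = {}"
  shows "towards_end T (rays_in O') = O'"
proof
  show "towards_end T (rays_in O') \<subseteq> O'" using rays_in_arc by (auto simp: towards_end_def)
  show "O' \<subseteq> towards_end T (rays_in O')"
    using rays_in_from_arc[OF O'] confluent_arcs[OF O'(1)]
    unfolding towards_end_def by blast
qed

section \<open>The inverse of \<open>towards T\<close>\<close>

definition attractor :: "'a set \<Rightarrow> ('v, 'a) graph + (nat \<Rightarrow> 'a) set" where
  "attractor O' = (if sinks O' = {} then Inr (rays_in O') else Inl (sink_subgraph O'))"

lemma confluent_towards: "z \<in> {S. subtree S T} <+> ends T \<Longrightarrow> confluent (towards T z)"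
  using confluent_towards_subtree confluent_towards_end by (auto simp: towards_def)

text \<open>The test for sinks recognises the kind of \<open>z\<close>: a subtree has vertices, and
  these are sinks, whereas every vertex starts a ray of a given end.\<close>

lemma attractor_towards:
  assumes "z \<in> {S. subtree S T} <+> ends T"
  shows "attractor (towards T z) = z"
  using assms
proof
  fix S assume S: "S \<in> {S. subtree S T}" and z: "z = Inl S"
  then have "verts S \<noteq> {}" by (simp add: subtree_def)
  then show ?thesis
    using S z sinks_towards_subtree sink_subgraph_towards by (simp add: attractor_def towards_def)
next
  fix \<xi> assume "\<xi> \<in> ends T" "z = Inr \<xi>"
  then show ?thesis
    using sinks_towards_end rays_in_towards_end by (simp add: attractor_def towards_def)
qed

lemma towards_attractor:
  assumes "confluent O'"
  shows "towards T (attractor O') = O'"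
  using towards_sink_subgraph[OF assms] towards_rays_in[OF assms]
  by (simp add: attractor_def towards_def)

end


section \<open>Invariance under the group\<close>

lemma (in group_action) inverse_acts:
  assumes "g \<in> carrier G" "x \<in> E"
  shows "\<phi> (inv g) (\<phi> g x) = x" "\<phi> g (\<phi> (inv g) x) = x"
proof -
  interpret group G using group_hom group_hom.axioms(1) by auto
  show "\<phi> (inv g) (\<phi> g x) = x" using orbit_sym_aux assms by blast
  show "\<phi> g (\<phi> (inv g) x) = x" using orbit_sym_aux[of "inv g" x] assms by simp
qed

lemma (in group_action) inverse_closed: "g \<in> carrier G \<Longrightarrow> inv g \<in> carrier G"
  by (rule group.inv_closed[OF group_hom.axioms(1)[OF group_hom]])

lemma (in group_action) acts_closed: "\<lbrakk>g \<in> carrier G; x \<in> E\<rbrakk> \<Longrightarrow> \<phi> g x \<in> E"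
  using element_image by blast

lemma (in group_action) acts_inj:
  "\<lbrakk>g \<in> carrier G; x \<in> E; y \<in> E; \<phi> g x = \<phi> g y\<rbrakk> \<Longrightarrow> x = y"
  using inverse_acts(1) by metis

lemma (in group_action) orbit_eq_iff:
  assumes "x \<in> E" "y \<in> E"
  shows "orbit G \<phi> x = orbit G \<phi> y \<longleftrightarrow> (\<exists>g\<in>carrier G. \<phi> g x = y)"
proof
  assume "orbit G \<phi> x = orbit G \<phi> y"
  then have "y \<in> orbit G \<phi> x" using orbit_refl assms by blast
  then show "\<exists>g\<in>carrier G. \<phi> g x = y" by (auto simp: orbit_def)
next
  assume "\<exists>g\<in>carrier G. \<phi> g x = y"
  then have y: "y \<in> orbit G \<phi> x" by (auto simp: orbit_def)
  have closed: "orbit G \<phi> z \<subseteq> E" if "z \<in> E" for z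
    using acts_closed that by (auto simp: orbit_def)
  show "orbit G \<phi> x = orbit G \<phi> y"
    using y orbit_sym[OF assms y] orbit_trans closed assms by blast
qed

text \<open>Closure under the inverse of \<open>g\<close> yields the reverse inclusion.\<close>

lemma (in group_action) invariant_image_eq:
  assumes "A \<subseteq> E" "\<And>g x. \<lbrakk>g \<in> carrier G; x \<in> A\<rbrakk> \<Longrightarrow> \<phi> g x \<in> A" "g \<in> carrier G"
  shows "\<phi> g ` A = A"
proof
  show "\<phi> g ` A \<subseteq> A" using assms by blast
  show "A \<subseteq> \<phi> g ` A"
  proof
    fix x assume "x \<in> A"
    then have "\<phi> (inv g) x \<in> A" "\<phi> g (\<phi> (inv g) x) = x"
      using assms inverse_closed inverse_acts by auto
    then show "x \<in> \<phi> g ` A" by (metis imageI)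
  qed
qed

locale tree_action = graph_action G T \<phi> \<psi> + tree_graph T
  for G :: "('g, 'm) monoid_scheme" and T :: "('v, 'a) graph" and \<phi> \<psi>
begin

sublocale V: group_action G "verts T" \<phi>
  by (rule verts_action)

sublocale A: group_action G "arcs T" \<psi>
  by (rule arcs_action)

lemma terminus_equivariant:
  "\<lbrakk>g \<in> carrier G; a \<in> arcs T\<rbrakk> \<Longrightarrow> terminus T (\<psi> g a) = \<phi> g (terminus T a)"
  unfolding terminus_def using reversal_equivariant origin_equivariant by simp

definition invariant :: "'a set \<Rightarrow> bool" where
  "invariant O' \<longleftrightarrow> (\<forall>g\<in>carrier G. \<forall>a\<in>O'. \<psi> g a \<in> O')"

lemma walk_equivariant:
  assumes "g \<in> carrier G" "walk T u p v"
  shows "walk T (\<phi> g u) (map (\<psi> g) p) (\<phi> g v)"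
  using assms(2)
proof (induction p arbitrary: u)
  case Nil
  then show ?case using V.acts_closed[of g v] assms(1) by auto
next
  case (Cons a p)
  then show ?case
    using assms(1) A.acts_closed origin_equivariant terminus_equivariant
    by (auto simp: out_arcs_def)
qed

lemma reduced_equivariant:
  assumes g: "g \<in> carrier G" and "set p \<subseteq> arcs T" "reduced T p"
  shows "reduced T (map (\<psi> g) p)"
  using assms(2,3)
proof (induction p)
  case (Cons a p)
  have "hd (map (\<psi> g) p) \<noteq> reversal T (\<psi> g a)" if ne: "p \<noteq> []"
  proof
    assume "hd (map (\<psi> g) p) = reversal T (\<psi> g a)"
    then have "\<psi> g (hd p) = \<psi> g (reversal T a)"
      using ne reversal_equivariant[OF g, of a] Cons.prems by (simp add: hd_map)
    moreover have "hd p \<in> arcs T" "a \<in> arcs T" using ne Cons.prems by auto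
    ultimately have "hd p = reversal T a"
      using A.acts_inj[OF g] by simp
    then show False using Cons.prems ne by (simp add: reduced_Cons)
  qed
  then show ?case using Cons by (auto simp: reduced_Cons)
qed auto

lemma invariant_towards_subtree:
  assumes S: "S \<in> invariant_subtrees G T \<phi> \<psi>"
  shows "invariant (towards_subtree T S)"
  unfolding invariant_def
proof (intro ballI)
  fix g a assume g: "g \<in> carrier G" and a: "a \<in> towards_subtree T S"
  have sub: "subtree S T" and gS: "\<phi> g ` verts S = verts S"
    using S g by (auto simp: invariant_subtrees_def)
  obtain p w where p: "entry_path (verts S) (origin T a) (a # p) w"
    using towards_subtree_iff[OF sub] a by blast
  then have arcs: "set (a # p) \<subseteq> arcs T" using walk_arcs unfolding entry_path_def by blast
  \<comment> \<open>As \<open>g\<close> maps \<open>verts S\<close> onto itself and is injective on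
    vertices, it moves no vertex from outside \<open>S\<close> into \<open>S\<close>.\<close>
  have "origin T (\<psi> g b) \<notin> verts S" if b: "b \<in> set (a # p)" for b
  proof
    assume "origin T (\<psi> g b) \<in> verts S"
    then obtain x where "x \<in> verts S" "\<phi> g (origin T b) = \<phi> g x"
      using gS arcs b origin_equivariant[OF g, of b] by (metis imageE subsetD)
    moreover have "x \<in> verts T" "origin T b \<in> verts T"
      using calculation subtree_verts[OF sub] arcs b by auto
    ultimately have "origin T b \<in> verts S" using V.acts_inj[OF g] by metis
    then show False using p b by (auto simp: entry_path_def)
  qed
  then have "entry_path (verts S) (\<phi> g (origin T a)) (map (\<psi> g) (a # p)) (\<phi> g w)"
    using p g gS walk_equivariant[OF g] reduced_equivariant[OF g arcs]
    unfolding entry_path_def by (metis (no_types, lifting) imageE imageI list.set_map)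
  moreover have "\<phi> g (origin T a) = origin T (\<psi> g a)"
    using origin_equivariant[OF g] arcs by simp
  ultimately show "\<psi> g a \<in> towards_subtree T S"
    using towards_subtree_iff[OF sub] by (metis list.simps(9))
qed

lemma invariant_towards_end:
  assumes "\<xi> \<in> fixed_ends G T \<psi>"
  shows "invariant (towards_end T \<xi>)"
  unfolding invariant_def
proof (intro ballI)
  fix g a assume g: "g \<in> carrier G" and "a \<in> towards_end T \<xi>"
  then obtain r where r: "r \<in> \<xi>" "r 0 = a" "a \<in> arcs T" by (auto simp: towards_end_def)
  then have "\<psi> g \<circ> r \<in> \<xi>" using assms g by (auto simp: fixed_ends_def)
  then show "\<psi> g a \<in> towards_end T \<xi>"
    using r A.acts_closed[OF g]
    by (auto simp: towards_end_def intro!: bexI[of _ "\<psi> g \<circ> r"])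
qed

lemma invariant_towards:
  "z \<in> invariant_subtrees G T \<phi> \<psi> <+> fixed_ends G T \<psi> \<Longrightarrow> invariant (towards T z)"
  using invariant_towards_subtree invariant_towards_end by (auto simp: towards_def)

text \<open>The inverse of \<open>g\<close> would carry an arc of \<open>O'\<close> leaving
  \<open>\<phi> g v\<close> to one leaving \<open>v\<close>.\<close>

lemma sinks_invariant:
  assumes "confluent O'" "invariant O'" "g \<in> carrier G" "v \<in> sinks O'"
  shows "\<phi> g v \<in> sinks O'"
proof -
  have v: "v \<in> verts T" using assms(4) by (simp add: sinks_def)
  have "origin T a \<noteq> \<phi> g v" if a: "a \<in> O'" for a
  proof
    assume "origin T a = \<phi> g v"
    then have "origin T (\<psi> (inv\<^bsub>G\<^esub> g) a) = v"
      using origin_equivariant[OF A.inverse_closed[OF assms(3)]] confluent_arcs[OF assms(1) a]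
        V.inverse_acts(1)[OF assms(3) v] by simp
    moreover have "\<psi> (inv\<^bsub>G\<^esub> g) a \<in> O'"
      using assms(2) A.inverse_closed[OF assms(3)] a by (simp add: invariant_def)
    ultimately show False using assms(4) by (auto simp: sinks_def)
  qed
  then show ?thesis using V.acts_closed[OF assms(3) v] by (auto simp: sinks_def)
qed

lemma ray_equivariant:
  assumes g: "g \<in> carrier G" and r: "r \<in> rays T"
  shows "\<psi> g \<circ> r \<in> rays T"
proof -
  have "inj (\<lambda>n. origin T ((\<psi> g \<circ> r) n))"
  proof (rule injI)
    fix m n assume "origin T ((\<psi> g \<circ> r) m) = origin T ((\<psi> g \<circ> r) n)"
    then have "origin T (r m) = origin T (r n)"
      using origin_equivariant[OF g] ray_arcs[OF r] V.acts_inj[OF g] by simp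
    then show "m = n" using ray_origin_inj[OF r] by simp
  qed
  then show ?thesis
    using A.acts_closed[OF g] terminus_equivariant[OF g] origin_equivariant[OF g]
      ray_arcs[OF r] ray_origin_Suc[OF r]
    by (simp add: rays_def)
qed

lemma rays_in_invariant:
  assumes "confluent O'" "invariant O'" "g \<in> carrier G"
  shows "(\<lambda>r. \<psi> g \<circ> r) ` rays_in O' = rays_in O'"
proof -
  have closed: "\<psi> h \<circ> r \<in> rays_in O'" if "h \<in> carrier G" "r \<in> rays_in O'" for h r
    using that ray_equivariant assms(2) by (auto simp: rays_in_def invariant_def)
  have "r \<in> (\<lambda>r. \<psi> g \<circ> r) ` rays_in O'" if r: "r \<in> rays_in O'" for r
  proof
    have "r n \<in> arcs T" for n using r ray_arcs by (auto simp: rays_in_def)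
    then show "r = \<psi> g \<circ> (\<psi> (inv\<^bsub>G\<^esub> g) \<circ> r)"
      using A.inverse_acts(2)[OF assms(3)] by (simp add: fun_eq_iff)
    show "\<psi> (inv\<^bsub>G\<^esub> g) \<circ> r \<in> rays_in O'"
      using closed r A.inverse_closed assms(3) by blast
  qed
  then show ?thesis using closed assms(3) by blast
qed

lemma attractor_invariant:
  assumes "confluent O'" "invariant O'"
  shows "attractor O' \<in> invariant_subtrees G T \<phi> \<psi> <+> fixed_ends G T \<psi>"
proof (cases "sinks O' = {}")
  case True
  then have "rays_in O' \<in> fixed_ends G T \<psi>"
    using rays_in_end rays_in_invariant assms by (simp add: fixed_ends_def)
  then show ?thesis using True by (auto simp: attractor_def)
next
  case False
  let ?S = "sink_subgraph O'"
  have "\<phi> g ` verts ?S = verts ?S" "\<psi> g ` arcs ?S = arcs ?S" if g: "g \<in> carrier G" for g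
  proof -
    show "\<phi> g ` verts ?S = verts ?S"
      using sinks_invariant[OF assms] g by (intro V.invariant_image_eq) (auto simp: sinks_def)
    show "\<psi> g ` arcs ?S = arcs ?S"
      using sinks_invariant[OF assms] g A.acts_closed origin_equivariant terminus_equivariant
      by (intro A.invariant_image_eq) auto
  qed
  then have "?S \<in> invariant_subtrees G T \<phi> \<psi>"
    using subtree_sink_subgraph[OF assms(1) False] by (simp add: invariant_subtrees_def)
  then show ?thesis using False by (auto simp: attractor_def)
qed


section \<open>Scopos of the local action diagram\<close>

lemma origin_orbit:
  assumes "a \<in> arcs T"
  shows "origin T ` orbit G \<psi> a = orbit G \<phi> (origin T a)"
proof -
  have "origin T ` orbit G \<psi> a = (\<lambda>g. origin T (\<psi> g a)) ` carrier G"
    unfolding orbit_def by auto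
  also have "\<dots> = (\<lambda>g. \<phi> g (origin T a)) ` carrier G"
    using assms origin_equivariant by simp
  finally show ?thesis unfolding orbit_def by auto
qed

lemma reversal_orbit:
  assumes "a \<in> arcs T"
  shows "reversal T ` orbit G \<psi> a = orbit G \<psi> (reversal T a)"
proof -
  have "reversal T ` orbit G \<psi> a = (\<lambda>g. reversal T (\<psi> g a)) ` carrier G"
    unfolding orbit_def by auto
  also have "\<dots> = (\<lambda>g. \<psi> g (reversal T a)) ` carrier G"
    using assms reversal_equivariant by simp
  finally show ?thesis unfolding orbit_def by auto
qed

section \<open>Preimages under the quotient map\<close>

definition lift :: "'a set set \<Rightarrow> 'a set" where
  "lift P = {a \<in> arcs T. orbit G \<psi> a \<in> P}"

lemma invariant_lift: "invariant (lift P)"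
  unfolding invariant_def lift_def using A.acts_closed A.orbit_eq_iff by fastforce

text \<open>An invariant set of arcs is a union of orbits.\<close>

lemma lift_image:
  assumes "O' \<subseteq> arcs T" "invariant O'"
  shows "lift (orbit G \<psi> ` O') = O'"
proof
  show "lift (orbit G \<psi> ` O') \<subseteq> O'"
  proof
    fix a assume "a \<in> lift (orbit G \<psi> ` O')"
    then obtain b where b: "b \<in> O'" "orbit G \<psi> b = orbit G \<psi> a" "a \<in> arcs T"
      by (auto simp: lift_def)
    then obtain g where "g \<in> carrier G" "\<psi> g b = a" using A.orbit_eq_iff assms(1) by blast
    then show "a \<in> O'" using assms(2) b by (auto simp: invariant_def)
  qed
next
  show "O' \<subseteq> lift (orbit G \<psi> ` O')" using assms(1) unfolding lift_def by blast
qed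

lemma image_lift:
  assumes "P \<subseteq> orbits G (arcs T) \<psi>"
  shows "orbit G \<psi> ` lift P = P"
  using assms by (auto simp: lift_def orbits_def)

context
  fixes star :: "'v set \<Rightarrow> 'v"
  assumes star: "\<forall>v\<in>verts (quotient_graph G T \<phi> \<psi>). star v \<in> {w \<in> verts T. orbit G \<phi> w = v}"
begin

text \<open>\<open>X_a\<close> lives at the chosen vertex \<open>star ?v\<close>. A group element
  \<open>h\<close> taking the origin of \<open>a\<close> there identifies it with the arcs of the
  orbit of \<open>a\<close> leaving that origin, so the condition can be read at any
  representative.\<close>

lemma card_colours_eq_1_iff:
  assumes a: "a \<in> arcs T"
  shows "card (colours (associated_diagram G T \<phi> \<psi> star) (orbit G \<psi> a)) = 1 \<longleftrightarrow>
    (\<forall>b\<in>arcs T. origin T b = origin T a \<and> orbit G \<psi> b = orbit G \<psi> a \<longrightarrow> b = a)"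
    (is "card ?X = 1 \<longleftrightarrow> ?R")
proof -
  let ?v = "orbit G \<phi> (origin T a)"
  have X: "?X = {b \<in> arcs T. origin T b = star ?v \<and> orbit G \<psi> b = orbit G \<psi> a}"
    using origin_orbit[OF a]
    by (auto simp: associated_diagram_def quotient_graph_def out_arcs_def)
  have "?v \<in> verts (quotient_graph G T \<phi> \<psi>)"
    using a by (auto simp: quotient_graph_def orbits_def)
  then have "star ?v \<in> verts T" "orbit G \<phi> (origin T a) = orbit G \<phi> (star ?v)" using star by auto
  then obtain h where h: "h \<in> carrier G" "\<phi> h (origin T a) = star ?v"
    using V.orbit_eq_iff[of "origin T a" "star ?v"] a by auto
  have moved: "\<psi> h b \<in> ?X" if "b \<in> arcs T" "origin T b = origin T a" "orbit G \<psi> b = orbit G \<psi> a" for b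
  proof -
    have "orbit G \<psi> b = orbit G \<psi> (\<psi> h b)"
      using A.orbit_eq_iff A.acts_closed h(1) that(1) by blast
    then show ?thesis unfolding X using A.acts_closed h that origin_equivariant by simp
  qed
  show ?thesis
  proof
    assume "card ?X = 1"
    \<comment> \<open>Infinite sets have \<open>card\<close> equal to \<open>0\<close>, so the value
      \<open>1\<close> does mean a singleton.\<close>
    then obtain c where c: "?X = {c}" by (meson card_1_singletonE)
    show ?R
    proof (intro ballI impI)
      fix b assume "b \<in> arcs T" "origin T b = origin T a \<and> orbit G \<psi> b = orbit G \<psi> a"
      then show "b = a" using moved[of b] moved[of a] c a A.acts_inj[OF h(1)] by auto
    qed
  next
    assume R: ?R
    have "b = \<psi> h a" if "b \<in> ?X" for b
    proof -
      have b: "b \<in> arcs T" "origin T b = star ?v" "orbit G \<psi> b = orbit G \<psi> a"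
        using that unfolding X by auto
      let ?c = "\<psi> (inv\<^bsub>G\<^esub> h) b"
      have inv: "inv\<^bsub>G\<^esub> h \<in> carrier G" using A.inverse_closed h(1) by blast
      have "?c \<in> arcs T" using A.acts_closed inv b(1) by blast
      moreover have "origin T ?c = origin T a"
        using origin_equivariant[OF inv b(1)] b(2) h V.inverse_acts(1)[OF h(1), of "origin T a"] a
        by simp
      moreover have "orbit G \<psi> b = orbit G \<psi> ?c"
        using A.orbit_eq_iff[OF b(1) \<open>?c \<in> arcs T\<close>] inv by blast
      ultimately have "?c = a" using R b(3) by simp
      then show ?thesis using A.inverse_acts(2)[OF h(1) b(1)] by simp
    qed
    then have "?X = {\<psi> h a}" using moved[OF a] by blast
    then show "card ?X = 1" by simp
  qed
qed

text \<open>Moves the whole problem into \<open>T\<close>: since \<open>lift P\<close> is always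
  invariant, scopos become the invariant confluent sets, whatever the choice of
  \<open>star\<close>.\<close>

lemma scopo_iff:
  "scopo (associated_diagram G T \<phi> \<psi> star) P \<longleftrightarrow>
     P \<subseteq> orbits G (arcs T) \<psi> \<and> confluent (lift P)"
proof -
  let ?\<Delta> = "associated_diagram G T \<phi> \<psi> star"
  let ?\<pi> = "orbit G \<psi>"
  have base: "arcs (base ?\<Delta>) = orbits G (arcs T) \<psi>" "verts (base ?\<Delta>) = orbits G (verts T) \<phi>"
    "origin (base ?\<Delta>) A = origin T ` A" "reversal (base ?\<Delta>) A = reversal T ` A"
    "terminus (base ?\<Delta>) A = origin T ` reversal T ` A" for A
    by (auto simp: associated_diagram_def quotient_graph_def Let_def terminus_def)
  have term_orbit: "origin T ` reversal T ` ?\<pi> b = orbit G \<phi> (terminus T b)" if "b \<in> arcs T" for b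
    using reversal_orbit[OF that] origin_orbit[of "reversal T b"] that by simp
  show ?thesis
  proof
    assume sc: "scopo ?\<Delta> P"
    then have P: "P \<subseteq> orbits G (arcs T) \<psi>" by (simp add: scopo_def base)
    have "reversal T a \<notin> lift P \<and>
        (\<forall>b\<in>arcs T. terminus T b = origin T a \<and> b \<noteq> reversal T a \<longrightarrow> b \<in> lift P)"
      if "a \<in> lift P" for a
    proof (intro conjI ballI impI)
      have a: "a \<in> arcs T" "?\<pi> a \<in> P" using that by (auto simp: lift_def)
      then have rev: "?\<pi> (reversal T a) \<notin> P" and card: "card (colours ?\<Delta> (?\<pi> a)) = 1"
        using sc reversal_orbit[of a] by (auto simp: scopo_def base)
      then show "reversal T a \<notin> lift P" by (simp add: lift_def)
      fix b assume b: "b \<in> arcs T" "terminus T b = origin T a \<and> b \<noteq> reversal T a"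
      \<comment> \<open>This is where \<open>|X_a| = 1\<close> enters: it lets the excepted orbit
        contain no arc ending at the origin of \<open>a\<close> besides
        \<open>reversal T a\<close>.\<close>
      have "?\<pi> b \<noteq> ?\<pi> (reversal T a)"
      proof
        assume "?\<pi> b = ?\<pi> (reversal T a)"
        then have "?\<pi> (reversal T b) = ?\<pi> a"
          using reversal_orbit[of b] reversal_orbit[of "reversal T a"] a(1) b(1) by simp
        then have "reversal T b = a"
          using card b card_colours_eq_1_iff[OF a(1)] by simp
        then show False using b by auto
      qed
      moreover have "orbit G \<phi> (origin T a) \<in> orbits G (verts T) \<phi>" "?\<pi> b \<in> orbits G (arcs T) \<psi>"
        using a b by (auto simp: orbits_def)
      ultimately have "?\<pi> b \<in> P"
        using sc a b unfolding scopo_def base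
        by (metis origin_orbit reversal_orbit term_orbit)
      then show "b \<in> lift P" using b by (simp add: lift_def)
    qed
    then show "P \<subseteq> orbits G (arcs T) \<psi> \<and> confluent (lift P)"
      using P by (auto simp: confluent_def lift_def)
  next
    assume "P \<subseteq> orbits G (arcs T) \<psi> \<and> confluent (lift P)"
    then have P: "P \<subseteq> orbits G (arcs T) \<psi>" and conf: "confluent (lift P)" by auto
    have "reversal T ` A \<notin> P \<and> card (colours ?\<Delta> A) = 1 \<and>
        (\<forall>B\<in>orbits G (arcs T) \<psi>. origin T ` reversal T ` B = origin T ` A \<and> B \<noteq> reversal T ` A
           \<longrightarrow> B \<in> P)"
      if "A \<in> P" for A
    proof -
      obtain a where a: "a \<in> arcs T" "A = ?\<pi> a" using P \<open>A \<in> P\<close> unfolding orbits_def by blast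
      then have lift: "a \<in> lift P" using that by (simp add: lift_def)
      have 1: "reversal T ` A \<notin> P"
        using confluent_reversal[OF conf lift] a reversal_orbit by (simp add: lift_def)
      \<comment> \<open>An arc in the orbit of \<open>a\<close> with the same origin is in
        \<open>lift P\<close> as well, so it equals \<open>a\<close>.\<close>
      have 2: "card (colours ?\<Delta> A) = 1"
        unfolding a(2) card_colours_eq_1_iff[OF a(1)]
        using confluent_unique[OF conf _ lift] that a(2) by (simp add: lift_def)
      have 3: "B \<in> P" if B: "B \<in> orbits G (arcs T) \<psi>"
        "origin T ` reversal T ` B = origin T ` A" "B \<noteq> reversal T ` A" for B
      proof -
        obtain b where b: "b \<in> arcs T" "B = ?\<pi> b" using B(1) by (auto simp: orbits_def)
        then have "orbit G \<phi> (terminus T b) = orbit G \<phi> (origin T a)"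
          using B(2) a term_orbit origin_orbit by simp
        \<comment> \<open>\<open>b\<close> need only end in the orbit of the origin of
          \<open>a\<close>; a translate of \<open>b\<close> ends at that origin itself.\<close>
        then obtain g where g: "g \<in> carrier G" "\<phi> g (terminus T b) = origin T a"
          using V.orbit_eq_iff a b by auto
        have gb: "\<psi> g b \<in> arcs T" using A.acts_closed g b by blast
        then have "?\<pi> (\<psi> g b) = B" using A.orbit_eq_iff[OF b(1) gb] g b(2) by blast
        moreover from this have "\<psi> g b \<noteq> reversal T a"
          using B(3) a reversal_orbit by auto
        ultimately show "B \<in> P"
          using confluent_incoming[OF conf lift gb] terminus_equivariant g b(1)
          by (simp add: lift_def)
      qed
      show ?thesis using 1 2 3 by blast
    qed
    then show "scopo ?\<Delta> P"
      unfolding scopo_def base by (intro conjI ballI impI P) simp_all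
  qed
qed

end

end

theorem theorem1p4:
  fixes G :: "('g, 'm) monoid_scheme" and T :: "('v, 'a) graph"
    and \<phi> :: "'g \<Rightarrow> 'v \<Rightarrow> 'v" and \<psi> :: "'g \<Rightarrow> 'a \<Rightarrow> 'a"
    and star :: "'v set \<Rightarrow> 'v"
    and \<Delta> :: "('v set, 'a set, 'a) local_action_diagram"
    and \<pi> :: "'a \<Rightarrow> 'a set"
  assumes tree: "tree T"
    and action: "graph_action G T \<phi> \<psi>"
    and star: "\<forall>v\<in>verts (quotient_graph G T \<phi> \<psi>). star v \<in> {w \<in> verts T. orbit G \<phi> w = v}"
    and \<Delta>: "\<Delta> = associated_diagram G T \<phi> \<psi> star"
    and \<pi>: "\<pi> = orbit G \<psi>"
  shows "(\<forall>z \<in> invariant_subtrees G T \<phi> \<psi> <+> fixed_ends G T \<psi>.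
            scopo \<Delta> (\<pi> ` towards T z) \<and>
            {a \<in> arcs T. \<pi> a \<in> \<pi> ` towards T z} = towards T z) \<and>
         bij_betw (\<lambda>z. \<pi> ` towards T z)
           (invariant_subtrees G T \<phi> \<psi> <+> fixed_ends G T \<psi>) {O'. scopo \<Delta> O'} \<and>
         Inl T \<in> invariant_subtrees G T \<phi> \<psi> <+> fixed_ends G T \<psi> \<and>
         \<pi> ` towards T (Inl T) = {}"
proof -
  interpret tree_action G T \<phi> \<psi>
    using tree action by (simp add: tree_action_def tree_graph_def)
  let ?Z = "invariant_subtrees G T \<phi> \<psi> <+> fixed_ends G T \<psi>"
  have sub: "?Z \<subseteq> {S. subtree S T} <+> ends T"
    by (auto simp: invariant_subtrees_def fixed_ends_def)
  have conf: "confluent (towards T z)" and lift: "lift (\<pi> ` towards T z) = towards T z"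
    if "z \<in> ?Z" for z
  proof -
    show "confluent (towards T z)" using confluent_towards sub that by blast
    then show "lift (\<pi> ` towards T z) = towards T z"
      unfolding \<pi> using lift_image invariant_towards[OF that] by (simp add: confluent_def)
  qed
  have scopo: "scopo \<Delta> (\<pi> ` towards T z)" if "z \<in> ?Z" for z
    using conf[OF that] lift[OF that] unfolding \<Delta> scopo_iff[OF star]
    by (auto simp: \<pi> orbits_def confluent_def)
  have "bij_betw (\<lambda>z. \<pi> ` towards T z) ?Z {O'. scopo \<Delta> O'}"
  \<comment> \<open>The inverse pulls a scopo back to \<open>T\<close> and takes the subtree of
    sinks, or the end of rays inside it if there are no sinks.\<close>
  proof (rule bij_betw_byWitness[where f' = "\<lambda>P. attractor (lift P)"])
    show "\<forall>z\<in>?Z. attractor (lift (\<pi> ` towards T z)) = z"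
    proof
      fix z assume z: "z \<in> ?Z"
      show "attractor (lift (\<pi> ` towards T z)) = z"
        unfolding lift[OF z] using attractor_towards sub z by blast
    qed
    show "\<forall>P\<in>{O'. scopo \<Delta> O'}. \<pi> ` towards T (attractor (lift P)) = P"
      using towards_attractor image_lift by (simp add: \<Delta> \<pi> scopo_iff[OF star])
    show "(\<lambda>z. \<pi> ` towards T z) ` ?Z \<subseteq> {O'. scopo \<Delta> O'}" using scopo by blast
    show "(\<lambda>P. attractor (lift P)) ` {O'. scopo \<Delta> O'} \<subseteq> ?Z"
      using attractor_invariant invariant_lift by (auto simp: \<Delta> scopo_iff[OF star])
  qed
  moreover have "subtree T T"
    using tree by (simp add: tree_def subtree_def subgraph_def)
  then have "Inl T \<in> ?Z"
    using V.surj_prop A.surj_prop by (intro InlI) (simp add: invariant_subtrees_def)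
  \<comment> \<open>Arcs towards a subtree start outside it, and no arc starts outside
    \<open>T\<close>.\<close>
  moreover have "towards T (Inl T) = {}"
    by (auto simp: towards_def towards_subtree_def)
  ultimately show ?thesis using scopo lift by (simp add: lift_def \<pi>)
qed

end
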